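(* Let $V$ be a finite-dimensional connected braided vector space of diagonal type over a field $F$ of characteristic zero with $\dim V>1$, and let $\mathfrak B(V)$ be its Nichols algebra. Then the following are equivalent: (i) $\mathfrak B(V)$ is finite-dimensional; (ii) the Nichols L-bicharacter algebra $\mathfrak L(V)_L$ is finite-dimensional; (iii) the Nichols R-bicharacter algebra $\mathfrak L(V)_R$ is finite-dimensional.
   Context: $V$ has basis $x_1,\dots,x_n$ with braiding $C(x_i\otimes x_j)=p_{i,j}x_j\otimes x_i$, $p_{i,j}\in F^*$. Connected means: for all $i\ne j$ there is a sequence $i=i_0,i_1,\dots,i_k=j$ with $p_{i_s,i_{s+1}}p_{i_{s+1},i_s}\neq1$ for all $s$. $\mathfrak B(V)$ is the quotient of $T(V)$ by $\bigoplus_{m\ge2}\ker S_m$ (kernels of quantum symmetrizers); it is $\mathbb Z^n$-graded with $\deg x_i=e_i$. For homogeneous $u,v$ with $\deg u=\sum a_ie_i$, $\deg v=\sum b_je_j$ set $p_{u,v}=\prod_{i,j}p_{i,j}^{a_ib_j}$. Define, for homogeneous $u,v$ (extended bilinearly), $[u,v]_L=p_{v,u}uv-p_{u,v}vu$ and $[u,v]_R=p_{u,v}uv-p_{v,u}vu$; these are Lie brackets on $\mathfrak B(V)$. $\mathfrak L(V)_L$ (resp. $\mathfrak L(V)_R$) is the Lie subalgebra of $(\mathfrak B(V),[\cdot,\cdot]_L)$ (resp. $(\mathfrak B(V),[\cdot,\cdot]_R)$) generated by $V$. *)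

theory Defs
  imports "HOL-Combinatorics.Permutations" "HOL-Library.Function_Algebras"
begin

text \<open>Tensor algebra T(V) of V with basis x_0,...,x_{n-1}: finitely supported
  coefficient functions on words (lists of letters < n); the word w stands for
  x_{w!0} (x) ... (x) x_{w!(k-1)}. Braiding matrix p :: nat => nat => 'a.\<close>

definition supp :: "(nat list \<Rightarrow> 'a::zero) \<Rightarrow> nat list set" where
  "supp f = {w. f w \<noteq> 0}"

definition tens :: "nat \<Rightarrow> (nat list \<Rightarrow> 'a::zero) set" where
  "tens n = {f. finite (supp f) \<and> (\<forall>w. f w \<noteq> 0 \<longrightarrow> set w \<subseteq> {..<n})}"

definition single :: "nat list \<Rightarrow> nat list \<Rightarrow> 'a::{zero,one}" where
  "single w = (\<lambda>x. if x = w then 1 else 0)"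

definition scal :: "'a::times \<Rightarrow> (nat list \<Rightarrow> 'a) \<Rightarrow> nat list \<Rightarrow> 'a" where
  "scal c f = (\<lambda>x. c * f x)"

text \<open>Quantum symmetrizer S_m = sum over sigma in S_m of T_sigma (Matsumoto lift);
  for diagonal braiding T_sigma sends the letter at position a to position sigma a,
  with the factor p_{w_a,w_b} for every inversion a<b, sigma a > sigma b.\<close>

definition symm_word :: "(nat \<Rightarrow> nat \<Rightarrow> 'a::field) \<Rightarrow> nat list \<Rightarrow> nat list \<Rightarrow> 'a" where
  "symm_word p w =
     (\<Sum>\<sigma>\<in>{\<sigma>. \<sigma> permutes {..<length w}}.
        scal (\<Prod>(a,b)\<in>{(a,b). a < b \<and> b < length w \<and> \<sigma> b < \<sigma> a}. p (w!a) (w!b))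
             (single (map (\<lambda>i. w ! (inv \<sigma> i)) [0..<length w])))"

definition symm :: "(nat \<Rightarrow> nat \<Rightarrow> 'a::field) \<Rightarrow> nat \<Rightarrow> (nat list \<Rightarrow> 'a) \<Rightarrow> nat list \<Rightarrow> 'a" where
  "symm p m f = (\<Sum>w\<in>{w\<in>supp f. length w = m}. scal (f w) (symm_word p w))"

definition hcomp :: "nat \<Rightarrow> (nat list \<Rightarrow> 'a::zero) \<Rightarrow> nat list \<Rightarrow> 'a" where
  "hcomp m f = (\<lambda>w. if length w = m then f w else 0)"

text \<open>The ideal I = direct sum over m >= 2 of ker S_m; B(V) = T(V)/I.\<close>
definition nichols_ideal :: "nat \<Rightarrow> (nat \<Rightarrow> nat \<Rightarrow> 'a::field) \<Rightarrow> (nat list \<Rightarrow> 'a) set" where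
  "nichols_ideal n p = {f \<in> tens n. (\<forall>w. length w < 2 \<longrightarrow> f w = 0) \<and>
                          (\<forall>m\<ge>2. symm p m (hcomp m f) = 0)}"

definition pw :: "(nat \<Rightarrow> nat \<Rightarrow> 'a::comm_monoid_mult) \<Rightarrow> nat list \<Rightarrow> nat list \<Rightarrow> 'a" where
  "pw p u v = (\<Prod>a<length u. \<Prod>b<length v. p (u!a) (v!b))"

definition bracketL :: "(nat \<Rightarrow> nat \<Rightarrow> 'a::field) \<Rightarrow> (nat list \<Rightarrow> 'a) \<Rightarrow> (nat list \<Rightarrow> 'a) \<Rightarrow> nat list \<Rightarrow> 'a" where
  "bracketL p f g = (\<Sum>u\<in>supp f. \<Sum>v\<in>supp g.
      scal (f u * g v) (scal (pw p v u) (single (u @ v)) - scal (pw p u v) (single (v @ u))))"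

definition bracketR :: "(nat \<Rightarrow> nat \<Rightarrow> 'a::field) \<Rightarrow> (nat list \<Rightarrow> 'a) \<Rightarrow> (nat list \<Rightarrow> 'a) \<Rightarrow> nat list \<Rightarrow> 'a" where
  "bracketR p f g = (\<Sum>u\<in>supp f. \<Sum>v\<in>supp g.
      scal (f u * g v) (scal (pw p u v) (single (u @ v)) - scal (pw p v u) (single (v @ u))))"

text \<open>Lie subalgebra generated by V (computed in T(V); its image in B(V) is L(V)).\<close>
inductive_set lie_gen :: "nat \<Rightarrow> ((nat list \<Rightarrow> 'a::field) \<Rightarrow> (nat list \<Rightarrow> 'a) \<Rightarrow> nat list \<Rightarrow> 'a)
                          \<Rightarrow> (nat list \<Rightarrow> 'a) set"
  for n br where
  gen: "i < n \<Longrightarrow> single [i] \<in> lie_gen n br"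
| zero: "0 \<in> lie_gen n br"
| add: "f \<in> lie_gen n br \<Longrightarrow> g \<in> lie_gen n br \<Longrightarrow> f + g \<in> lie_gen n br"
| smult: "f \<in> lie_gen n br \<Longrightarrow> scal c f \<in> lie_gen n br"
| br: "f \<in> lie_gen n br \<Longrightarrow> g \<in> lie_gen n br \<Longrightarrow> br f g \<in> lie_gen n br"

definition fin_dim_mod :: "(nat list \<Rightarrow> 'a::field) set \<Rightarrow> (nat list \<Rightarrow> 'a) set \<Rightarrow> bool" where
  "fin_dim_mod S I = (\<exists>B. finite B \<and> (\<forall>f\<in>S. \<exists>c. f - (\<Sum>b\<in>B. scal (c b) b) \<in> I))"

definition connected_diag :: "nat \<Rightarrow> (nat \<Rightarrow> nat \<Rightarrow> 'a::field) \<Rightarrow> bool" where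
  "connected_diag n p = (\<forall>i<n. \<forall>j<n. i \<noteq> j \<longrightarrow>
     (\<exists>l. l \<noteq> [] \<and> hd l = i \<and> last l = j \<and> set l \<subseteq> {..<n} \<and>
          (\<forall>s. Suc s < length l \<longrightarrow> p (l!s) (l!Suc s) * p (l!Suc s) (l!s) \<noteq> 1)))"

end

(* The ideal I = nichols_ideal is described by skew derivations: I consists of the tensors
   all of whose iterated skew derivatives vanish. For a bicharacter s, the bracket bracketR s is
   the commutator of the associative product u * v = pw s u v (u @ v), and I is an ideal for this
   product as well; bracketL p is the case of the transposed matrix. Suppose that the Lie algebra L
   generated by the letters is finite-dimensional modulo I. As L is graded, all long iterated
   brackets of letters lie in I.

   Each letter x_i is nilpotent modulo I: choose a letter x_j with p_ij p_ji <> 1. If no quantum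
   integer 1 + q + ... + q^(m-1), q = p_ii, vanished, then skew derivatives of (ad x_i)^m x_j in I
   would force p_ij = s_ji / s_ij = 1 / p_ji.

   Finally the brackets are divided out one at a time, the short ones last. When all longer
   brackets have become zero, a bracket c = [x_i, z] is central, so that applying ad z repeatedly
   to x_i^N = 0 gives N! c^N = 0. Hence the algebra is finite-dimensional if its quotient by c is,
   and the quotient by all letters is the ground field. *)
theory Submission
  imports Defs Complex_Main
begin

section \<open>Quantum symmetrizers\<close>

lemma sum_fun_apply: "(\<Sum>a\<in>A. f a) x = (\<Sum>a\<in>A. f a x)"
  by (induction A rule: infinite_finite_induct) auto

text \<open>The character of the free monoid with values \<open>c\<close> on the letters;
  \<open>chi (p i) w\<close> is the bicharacter value of \<open>x_i\<close> against
  \<open>w\<close>.\<close>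

definition chi :: "(nat \<Rightarrow> 'a::comm_monoid_mult) \<Rightarrow> nat list \<Rightarrow> 'a" where
  "chi c w = prod_list (map c w)"

lemma chi_simps [simp]:
  "chi c [] = 1" "chi c (k # w) = c k * chi c w" "chi c (u @ v) = chi c u * chi c v"
  by (simp_all add: chi_def)

lemma chi_conv_prod: "chi c w = (\<Prod>b<length w. c (w ! b))"
  by (induction w) (simp_all del: prod.lessThan_Suc add: prod.lessThan_Suc_shift)

section \<open>Permutations sorted by the position that is moved to the end\<close>

definition rem_nth :: "nat \<Rightarrow> 'b list \<Rightarrow> 'b list" where
  "rem_nth a w = take a w @ drop (Suc a) w"

text \<open>The increasing bijection onto the numbers other than \<open>a\<close>; it carries
  positions of \<open>rem_nth a w\<close> to positions of \<open>w\<close>.\<close>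

definition shift :: "nat \<Rightarrow> nat \<Rightarrow> nat" where
  "shift a x = (if x < a then x else Suc x)"

lemma shift_less_iff [simp]: "shift a x < shift a y \<longleftrightarrow> x < y"
  by (auto simp: shift_def)

lemma shift_neq [simp]: "shift a x \<noteq> a" "a \<noteq> shift a x"
  by (auto simp: shift_def)

lemma shift_eq_iff [simp]: "shift a x = shift a y \<longleftrightarrow> x = y"
  by (auto simp: shift_def split: if_splits)

lemma shift_cases:
  assumes "y \<noteq> a" obtains x where "y = shift a x"
  using assms by (cases "y < a") (auto simp: shift_def intro: that[of "y - 1"] that[of y])

lemma shift_less_Suc: "a \<le> m \<Longrightarrow> shift a x < Suc m \<longleftrightarrow> x < m"
  by (auto simp: shift_def)

lemma length_rem_nth [simp]: "a < length w \<Longrightarrow> length (rem_nth a w) = length w - 1"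
  by (auto simp: rem_nth_def)

lemma nth_rem_nth: "a < length w \<Longrightarrow> rem_nth a w ! x = w ! shift a x"
  by (auto simp: rem_nth_def shift_def nth_append min_def)

text \<open>The permutation sending \<open>a\<close> to the last position \<open>m\<close> and acting as \<open>\<tau>\<close> on the rest.\<close>
definition ext_perm :: "nat \<Rightarrow> nat \<Rightarrow> (nat \<Rightarrow> nat) \<Rightarrow> nat \<Rightarrow> nat" where
  "ext_perm m a \<tau> x =
     (if x = a then m else if x < a then \<tau> x else if x \<le> m then \<tau> (x - 1) else x)"

lemma ext_perm_a [simp]: "ext_perm m a \<tau> a = m"
  by (simp add: ext_perm_def)

lemma ext_perm_shift: "x < m \<Longrightarrow> ext_perm m a \<tau> (shift a x) = \<tau> x"
  by (auto simp: ext_perm_def shift_def)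

lemma ext_perm_permutes:
  assumes "a \<le> m" "\<tau> permutes {..<m}"
  shows "ext_perm m a \<tau> permutes {..<Suc m}"
proof (rule bij_imp_permutes)
  have less: "x < m \<Longrightarrow> \<tau> x < m" for x using permutes_in_image[OF assms(2), of x] by simp
  have inj: "inj_on (ext_perm m a \<tau>) {..<Suc m}"
  proof (rule inj_onI)
    fix x y assume xy: "x \<in> {..<Suc m}" "y \<in> {..<Suc m}" "ext_perm m a \<tau> x = ext_perm m a \<tau> y"
    show "x = y"
    proof (cases "x = a"; cases "y = a")
      assume "x \<noteq> a" "y \<noteq> a"
      then obtain x' y' where [simp]: "x = shift a x'" "y = shift a y'"
        by (meson shift_cases)
      show ?thesis using xy assms permutes_inj[OF assms(2)]
        by (simp add: shift_less_Suc ext_perm_shift inj_eq del: lessThan_Suc)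
    next
      assume "x = a" "y \<noteq> a"
      then obtain y' where "y = shift a y'" by (meson shift_cases)
      then show ?thesis using xy assms less[of y'] \<open>x = a\<close>
        by (simp add: shift_less_Suc ext_perm_shift del: lessThan_Suc)
    next
      assume "x \<noteq> a" "y = a"
      then obtain y' where "x = shift a y'" by (meson shift_cases)
      then show ?thesis using xy assms less[of y'] \<open>y = a\<close>
        by (simp add: shift_less_Suc ext_perm_shift del: lessThan_Suc)
    qed auto
  qed
  have "ext_perm m a \<tau> ` {..<Suc m} \<subseteq> {..<Suc m}"
  proof safe
    fix x assume "x < Suc m"
    show "ext_perm m a \<tau> x < Suc m"
    proof (cases "x = a")
      case False
      then obtain x' where "x = shift a x'" by (meson shift_cases)
      then show ?thesis using \<open>x < Suc m\<close> assms less[of x']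
        by (simp add: shift_less_Suc ext_perm_shift less_SucI)
    qed simp
  qed
  with inj show "bij_betw (ext_perm m a \<tau>) {..<Suc m} {..<Suc m}"
    using endo_inj_surj[OF finite_lessThan] by (simp add: bij_betw_def del: lessThan_Suc)
  show "ext_perm m a \<tau> x = x" if "x \<notin> {..<Suc m}" for x
    using that assms by (auto simp: ext_perm_def)
qed

text \<open>Injectivity and the count \<open>(m + 1) m! = (m + 1)!\<close> together give
  surjectivity.\<close>

lemma ext_perm_bij:
  "bij_betw (\<lambda>(a, \<tau>). ext_perm m a \<tau>) ({..m} \<times> {\<tau>. \<tau> permutes {..<m}}) {\<sigma>. \<sigma> permutes {..<Suc m}}"
proof -
  let ?F = "\<lambda>(a, \<tau>). ext_perm m a \<tau>" and ?A = "{..m} \<times> {\<tau>. \<tau> permutes {..<m}}"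
  have inj: "inj_on ?F ?A"
  proof (rule inj_onI; clarify)
    fix a \<tau> b \<rho>
    assume h: "a \<le> m" "\<tau> permutes {..<m}" "b \<le> m" "\<rho> permutes {..<m}"
      and eq: "ext_perm m a \<tau> = ext_perm m b \<rho>"
    have "ext_perm m b \<rho> a = ext_perm m b \<rho> b" using ext_perm_a[of m a \<tau>] by (simp add: eq)
    then have ab: "a = b" using permutes_inj[OF ext_perm_permutes[OF h(3,4)]] by (rule injD[rotated])
    moreover have "\<tau> x = \<rho> x" for x
    proof (cases "x < m")
      case True
      then show ?thesis using fun_cong[OF eq, of "shift a x"] ab by (simp add: ext_perm_shift)
    next
      case False
      then show ?thesis using h by (auto simp: permutes_def)
    qed
    ultimately show "a = b \<and> \<tau> = \<rho>" by auto
  qed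
  have "?F ` ?A \<subseteq> {\<sigma>. \<sigma> permutes {..<Suc m}}"
    using ext_perm_permutes by auto
  moreover have "card (?F ` ?A) = card {\<sigma>. \<sigma> permutes {..<Suc m}}"
    using card_permutations[of "{..<m}" m] card_permutations[of "{..<Suc m}" "Suc m"]
    by (simp add: card_image[OF inj] card_cartesian_product del: lessThan_Suc)
  ultimately have "?F ` ?A = {\<sigma>. \<sigma> permutes {..<Suc m}}"
    by (intro card_subset_eq finite_permutations) auto
  with inj show ?thesis by (simp add: bij_betw_def)
qed

definition inversions :: "nat \<Rightarrow> (nat \<Rightarrow> nat) \<Rightarrow> (nat \<times> nat) set" where
  "inversions m \<sigma> = {(a, b). a < b \<and> b < m \<and> \<sigma> b < \<sigma> a}"

lemma finite_inversions [simp]: "finite (inversions m \<sigma>)"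
  by (rule finite_subset[of _ "{..<m} \<times> {..<m}"]) (auto simp: inversions_def)

text \<open>Position \<open>a\<close> receives the largest value, so it is inverted with every later
  position and with no earlier one. The other inversions are those of \<open>\<tau>\<close>, since
  \<open>shift a\<close> preserves the order.\<close>

lemma inversions_ext_perm:
  assumes "a \<le> m" "\<tau> permutes {..<m}"
  shows "inversions (Suc m) (ext_perm m a \<tau>) =
           Pair a ` {a<..<Suc m} \<union> map_prod (shift a) (shift a) ` inversions m \<tau>" (is "?L = ?R")
proof -
  have less: "x < m \<Longrightarrow> \<tau> x < m" for x using permutes_in_image[OF assms(2), of x] by simp
  have mem: "(x, y) \<in> ?L \<longleftrightarrow> (x, y) \<in> ?R" for x y
  proof (cases "x = a")
    case True
    have "ext_perm m a \<tau> y < m" if "a < y" "y < Suc m"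
    proof -
      have "y \<noteq> a" using that(1) by simp
      then obtain y' where "y = shift a y'" by (meson shift_cases)
      then show ?thesis using that assms less[of y'] by (simp add: shift_less_Suc ext_perm_shift)
    qed
    with True show ?thesis by (auto simp: inversions_def)
  next
    case False
    then obtain x' where x: "x = shift a x'" by (meson shift_cases)
    show ?thesis
    proof (cases "y = a")
      case True
      have "\<not> m < ext_perm m a \<tau> x" if "x < a"
        using less[of x'] that x assms(1) by (auto simp: ext_perm_def less_Suc_eq_le shift_def
            dest: less split: if_splits)
      with True x show ?thesis by (auto simp: inversions_def)
    next
      case False
      then obtain y' where y: "y = shift a y'" by (meson shift_cases)
      show ?thesis using assms
        by (auto simp: x y inversions_def shift_less_Suc ext_perm_shift map_prod_def)
    qed
  qed
  then show ?thesis by auto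
qed

lemma inv_ext_perm:
  assumes "a \<le> m" "\<tau> permutes {..<m}"
  shows "inv (ext_perm m a \<tau>) m = a"
    and "x < m \<Longrightarrow> inv (ext_perm m a \<tau>) x = shift a (inv \<tau> x)"
proof -
  show "inv (ext_perm m a \<tau>) m = a"
    by (simp add: permutes_inv_eq[OF ext_perm_permutes[OF assms]])
  assume "x < m"
  moreover then have "inv \<tau> x < m" using permutes_in_image[OF permutes_inv[OF assms(2)], of x] by simp
  ultimately show "inv (ext_perm m a \<tau>) x = shift a (inv \<tau> x)"
    by (simp add: permutes_inv_eq[OF ext_perm_permutes[OF assms]] ext_perm_shift
        permutes_inverses[OF assms(2)])
qed

lemma symm_word_alt:
  "symm_word p w v =
     (\<Sum>\<sigma> | \<sigma> permutes {..<length w}. (\<Prod>(a, b)\<in>inversions (length w) \<sigma>. p (w ! a) (w ! b)) *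
        (if v = map (\<lambda>i. w ! inv \<sigma> i) [0..<length w] then 1 else 0))"
  by (simp add: symm_word_def sum_fun_apply scal_def single_def inversions_def)

text \<open>Splits the sum over permutations by the position whose letter is moved to the end.\<close>
lemma symm_word_snoc:
  "symm_word p w (v @ [i]) =
     (\<Sum>a<length w. if w ! a = i then chi (p i) (drop (Suc a) w) * symm_word p (rem_nth a w) v else 0)"
proof (cases "length w")
  case 0
  then show ?thesis by (simp add: symm_word_alt)
next
  case (Suc m)
  define P where "P \<sigma> u = (\<Prod>(a, b)\<in>inversions (length u) \<sigma>. p (u ! a) (u ! b))" for \<sigma> u
  define Q :: "_ \<Rightarrow> _ \<Rightarrow> _ \<Rightarrow> 'a" where
    "Q \<sigma> u v = (if v = map (\<lambda>i. u ! inv \<sigma> i) [0..<length u] then 1 else 0)" for \<sigma> and u v :: "nat list"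
  \<comment> \<open>The permuted word ends in \<open>w ! a\<close>, so only positions with the
    letter \<open>i\<close> contribute. Inversions starting at \<open>a\<close> produce the factor
    \<open>chi\<close>, the others the weight of \<open>\<tau>\<close> on the shortened
    word.\<close>
  have step: "P (ext_perm m a \<tau>) w * Q (ext_perm m a \<tau>) w (v @ [i]) =
      (if w ! a = i then chi (p i) (drop (Suc a) w) * (P \<tau> (rem_nth a w) * Q \<tau> (rem_nth a w) v) else 0)"
    if a: "a \<le> m" and \<tau>: "\<tau> permutes {..<m}" for a \<tau>
  proof -
    have len: "length (rem_nth a w) = m" using a Suc by simp
    have nth: "rem_nth a w ! x = w ! shift a x" for x using a Suc by (simp add: nth_rem_nth)
    have "map (\<lambda>x. w ! inv (ext_perm m a \<tau>) x) [0..<m] = map (\<lambda>x. rem_nth a w ! inv \<tau> x) [0..<m]"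
      by (simp add: inv_ext_perm(2)[OF a \<tau>] nth)
    then have Q: "Q (ext_perm m a \<tau>) w (v @ [i]) = (if w ! a = i then Q \<tau> (rem_nth a w) v else 0)"
      by (auto simp: Q_def Suc len inv_ext_perm(1)[OF a \<tau>])
    have inj: "inj_on (map_prod (shift a) (shift a)) (inversions m \<tau>)"
      by (auto simp: inj_on_def)
    have "P (ext_perm m a \<tau>) w = (\<Prod>(x, y)\<in>Pair a ` {a<..<Suc m}. p (w ! x) (w ! y)) *
        (\<Prod>(x, y)\<in>map_prod (shift a) (shift a) ` inversions m \<tau>. p (w ! x) (w ! y))"
      unfolding P_def Suc inversions_ext_perm[OF a \<tau>]
      by (rule prod.union_disjoint) auto
    also have "(\<Prod>(x, y)\<in>map_prod (shift a) (shift a) ` inversions m \<tau>. p (w ! x) (w ! y)) =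
        P \<tau> (rem_nth a w)"
      unfolding P_def len nth by (subst prod.reindex[OF inj]) (simp add: case_prod_unfold)
    also have "(\<Prod>(x, y)\<in>Pair a ` {a<..<Suc m}. p (w ! x) (w ! y)) = (\<Prod>y\<in>{a<..<Suc m}. p (w ! a) (w ! y))"
      by (subst prod.reindex) (auto simp: inj_on_def)
    also have "\<dots> = chi (p (w ! a)) (drop (Suc a) w)"
      unfolding chi_conv_prod
      by (rule prod.reindex_bij_witness[of _ "\<lambda>b. Suc a + b" "\<lambda>y. y - Suc a"]) (use a Suc in auto)
    finally show ?thesis by (simp add: Q mult.assoc)
  qed
  have "symm_word p w (v @ [i]) = (\<Sum>\<sigma> | \<sigma> permutes {..<Suc m}. P \<sigma> w * Q \<sigma> w (v @ [i]))"
    by (simp add: symm_word_alt P_def Q_def Suc del: lessThan_Suc upt_Suc)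
  also have "\<dots> = (\<Sum>(a, \<tau>)\<in>{..m} \<times> {\<tau>. \<tau> permutes {..<m}}.
      P (ext_perm m a \<tau>) w * Q (ext_perm m a \<tau>) w (v @ [i]))"
    by (subst sum.reindex_bij_betw[OF ext_perm_bij, symmetric]) (simp add: case_prod_unfold)
  also have "\<dots> = (\<Sum>a\<le>m. \<Sum>\<tau> | \<tau> permutes {..<m}.
      P (ext_perm m a \<tau>) w * Q (ext_perm m a \<tau>) w (v @ [i]))"
    by (rule sum.cartesian_product[symmetric])
  also have "\<dots> = (\<Sum>a\<le>m. if w ! a = i then chi (p i) (drop (Suc a) w) * symm_word p (rem_nth a w) v else 0)"
  proof (rule sum.cong[OF refl])
    fix a assume a: "a \<in> {..m}"
    have "symm_word p (rem_nth a w) v =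
        (\<Sum>\<tau> | \<tau> permutes {..<m}. P \<tau> (rem_nth a w) * Q \<tau> (rem_nth a w) v)"
      using a by (simp add: symm_word_alt P_def Q_def Suc)
    then show "(\<Sum>\<tau> | \<tau> permutes {..<m}. P (ext_perm m a \<tau>) w * Q (ext_perm m a \<tau>) w (v @ [i])) =
        (if w ! a = i then chi (p i) (drop (Suc a) w) * symm_word p (rem_nth a w) v else 0)"
      using a by (auto simp: step sum_distrib_left)
  qed
  also have "\<dots> = (\<Sum>a<length w. if w ! a = i then chi (p i) (drop (Suc a) w) * symm_word p (rem_nth a w) v else 0)"
    by (simp add: Suc lessThan_Suc_atMost)
  finally show ?thesis .
qed

section \<open>Skew derivations\<close>

interpretation tv: vector_space "scal :: 'a::field \<Rightarrow> (nat list \<Rightarrow> 'a) \<Rightarrow> nat list \<Rightarrow> 'a"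
  by unfold_locales (auto simp: scal_def algebra_simps)

section \<open>Multiplication by letters and twisting by characters\<close>

definition lmul :: "nat \<Rightarrow> (nat list \<Rightarrow> 'a::zero) \<Rightarrow> nat list \<Rightarrow> 'a" where
  "lmul i f w = (case w of [] \<Rightarrow> 0 | k # u \<Rightarrow> if k = i then f u else 0)"

definition rmul :: "nat \<Rightarrow> (nat list \<Rightarrow> 'a::zero) \<Rightarrow> nat list \<Rightarrow> 'a" where
  "rmul i f w = (if w \<noteq> [] \<and> last w = i then f (butlast w) else 0)"

text \<open>The endomorphism of the tensor algebra that scales the letter \<open>x_k\<close> by
  \<open>c k\<close>.\<close>

definition wt :: "(nat \<Rightarrow> 'a::comm_monoid_mult) \<Rightarrow> (nat list \<Rightarrow> 'a) \<Rightarrow> nat list \<Rightarrow> 'a" where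
  "wt c f w = chi c w * f w"

lemma lmul_eval [simp]:
  "lmul i f [] = 0" "lmul i f (k # u) = (if k = i then f u else 0)"
  by (simp_all add: lmul_def)

lemma rmul_eval [simp]:
  "rmul i f [] = 0" "rmul i f (u @ [k]) = (if k = i then f u else 0)"
  "rmul i f [k] = (if k = i then f [] else 0)"
  by (simp_all add: rmul_def)

lemma lmul_linear [simp]:
  fixes f g :: "nat list \<Rightarrow> 'a::field"
  shows "lmul i (f + g) = lmul i f + lmul i g" "lmul i (f - g) = lmul i f - lmul i g"
    "lmul i (scal c f) = scal c (lmul i f)" "lmul i 0 = (0 :: nat list \<Rightarrow> 'a)"
  by (auto simp: fun_eq_iff lmul_def scal_def split: list.splits)

lemma rmul_linear [simp]:
  fixes f g :: "nat list \<Rightarrow> 'a::field"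
  shows "rmul i (f + g) = rmul i f + rmul i g" "rmul i (f - g) = rmul i f - rmul i g"
    "rmul i (scal c f) = scal c (rmul i f)" "rmul i 0 = (0 :: nat list \<Rightarrow> 'a)"
  by (auto simp: fun_eq_iff rmul_def scal_def)

lemma wt_linear [simp]:
  fixes f g :: "nat list \<Rightarrow> 'a::field"
  shows "wt d (f + g) = wt d f + wt d g" "wt d (f - g) = wt d f - wt d g"
    "wt d (scal c f) = scal c (wt d f)" "wt d 0 = (0 :: nat list \<Rightarrow> 'a)"
  by (auto simp: fun_eq_iff wt_def scal_def algebra_simps)

lemma sum_lmul: "lmul i (\<Sum>a\<in>A. f a) = (\<Sum>a\<in>A. lmul i (f a))"
  for f :: "'b \<Rightarrow> nat list \<Rightarrow> 'a::field"
  using sum_comp_morphism[of "lmul i" f A] by (simp add: comp_def)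

lemma lmul_rmul: "lmul i (rmul j f) = rmul j (lmul i f)"
  for f :: "nat list \<Rightarrow> 'a::field"
  by (auto simp: fun_eq_iff lmul_def rmul_def split: list.splits)

lemma wt_lmul: "wt c (lmul i f) = scal (c i) (lmul i (wt c f))"
  for f :: "nat list \<Rightarrow> 'a::field"
  by (auto simp: fun_eq_iff lmul_def wt_def scal_def split: list.splits)

lemma wt_rmul: "wt c (rmul i f) = scal (c i) (rmul i (wt c f))"
  for f :: "nat list \<Rightarrow> 'a::field"
proof
  fix u show "wt c (rmul i f) u = scal (c i) (rmul i (wt c f)) u"
    by (cases u rule: rev_cases) (auto simp: wt_def scal_def)
qed

lemma wt_wt: "wt c (wt d f) = wt d (wt c f)"
  for f :: "nat list \<Rightarrow> 'a::field"
  by (auto simp: fun_eq_iff wt_def)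

lemma lmul_single [simp]: "lmul i (single w) = (single (i # w) :: nat list \<Rightarrow> 'a::field)"
  by (auto simp: fun_eq_iff lmul_def single_def split: list.splits)

lemma rmul_single [simp]: "rmul i (single w) = (single (w @ [i]) :: nat list \<Rightarrow> 'a::field)"
proof
  fix u show "rmul i (single w) u = (single (w @ [i]) u :: 'a)"
    by (cases u rule: rev_cases) (auto simp: single_def)
qed

lemma wt_single [simp]: "wt c (single w) = (scal (chi c w) (single w) :: nat list \<Rightarrow> 'a::field)"
  by (auto simp: fun_eq_iff wt_def scal_def single_def)

text \<open>The skew derivation with \<open>der p i (u v) = u (der p i v) + chi (p i) v (der p i u) v\<close>; in its
  coefficient functions it inserts the letter \<open>i\<close> at all places.\<close>
definition der :: "(nat \<Rightarrow> nat \<Rightarrow> 'a::field) \<Rightarrow> nat \<Rightarrow> (nat list \<Rightarrow> 'a) \<Rightarrow> nat list \<Rightarrow> 'a" where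
  "der p i f u = (\<Sum>a\<le>length u. f (take a u @ i # drop a u) * chi (p i) (drop a u))"

lemma der_Nil [simp]: "der p i f [] = f [i]"
  by (simp add: der_def)

lemma der_Cons: "der p i f (k # u) = f (i # k # u) * chi (p i) (k # u) + der p i (\<lambda>w. f (k # w)) u"
  by (simp add: der_def sum.atMost_Suc_shift del: sum.atMost_Suc)

lemma der_snoc: "der p i f (u @ [k]) = f (u @ [k, i]) + p i k * der p i (\<lambda>w. f (w @ [k])) u"
proof -
  have "(\<Sum>a\<le>length u. f (take a (u @ [k]) @ i # drop a (u @ [k])) * chi (p i) (drop a (u @ [k]))) =
        p i k * der p i (\<lambda>w. f (w @ [k])) u"
    unfolding der_def sum_distrib_left by (rule sum.cong) (auto simp: algebra_simps)
  then show ?thesis by (simp add: der_def)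
qed

lemma der_linear [simp]:
  "der p i (f + g) = der p i f + der p i g" "der p i (f - g) = der p i f - der p i g"
  "der p i (scal c f) = scal c (der p i f)" "der p i 0 = 0"
  by (auto simp: fun_eq_iff der_def scal_def algebra_simps sum.distrib sum_subtractf sum_distrib_left)

text \<open>The Leibniz rule with a letter as left factor: differentiating that letter leaves the
  unit or zero, at the price of twisting \<open>f\<close> by \<open>p i\<close>.\<close>

lemma der_lmul: "der p i (lmul j f) = lmul j (der p i f) + (if i = j then wt (p i) f else 0)"
proof
  fix u
  show "der p i (lmul j f) u = (lmul j (der p i f) + (if i = j then wt (p i) f else 0)) u"
  proof (cases u)
    case (Cons k v)
    have "(\<lambda>w. lmul j f (k # w)) = (if k = j then f else 0)" by auto
    then show ?thesis by (simp add: Cons der_Cons wt_def mult_ac)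
  qed (simp add: wt_def)
qed

lemma der_rmul: "der p i (rmul j f) = scal (p i j) (rmul j (der p i f)) + (if i = j then f else 0)"
proof
  fix u
  show "der p i (rmul j f) u = (scal (p i j) (rmul j (der p i f)) + (if i = j then f else 0)) u"
  proof (cases u rule: rev_cases)
    case (snoc v k)
    have "(\<lambda>w. rmul j f (w @ [k])) = (if k = j then f else 0)" by auto
    moreover have "rmul j f (v @ [k, i]) = (if i = j then f (v @ [k]) else 0)"
      using rmul_eval(2)[of j f "v @ [k]" i] by simp
    ultimately show ?thesis by (simp add: snoc der_snoc scal_def)
  qed (simp add: scal_def)
qed

lemma der_wt: "der p i (wt c f) = scal (c i) (wt c (der p i f))"
proof
  fix u
  have "chi c (take a u @ i # drop a u) = c i * chi c u" for a
    using chi_simps(3)[of c "take a u" "drop a u"] by (simp del: chi_simps(3) add: chi_simps(3)[of c _ "i # _"])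
  then show "der p i (wt c f) u = scal (c i) (wt c (der p i f)) u"
    by (simp add: der_def wt_def scal_def sum_distrib_left mult_ac del: chi_simps(3))
qed

lemma der_hcomp_0 [simp]: "der p i (hcomp 0 f) = 0"
  by (auto simp: fun_eq_iff der_def hcomp_def)

lemma der_hcomp_Suc [simp]: "der p i (hcomp (Suc m) f) = hcomp m (der p i f)"
  by (auto simp: fun_eq_iff der_def hcomp_def intro!: sum.neutral)

text \<open>Differentiating a word deletes one occurrence of \<open>i\<close> at a time, weighted by
  the letters behind it. This is the recursion that \<open>symm_word_snoc\<close> gives for the
  quantum symmetrizer.\<close>

lemma der_single:
  "der p i (single w) = (\<Sum>a<length w.
     if w ! a = i then scal (chi (p i) (drop (Suc a) w)) (single (rem_nth a w)) else 0)"
proof (induction w)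
  case Nil
  show ?case by (auto simp: fun_eq_iff der_def single_def)
next
  case (Cons k w)
  have "der p i (single (k # w)) = lmul k (der p i (single w)) + (if i = k then wt (p i) (single w) else 0)"
    using der_lmul[of p i k "single w"] by simp
  also have "\<dots> = (\<Sum>a<length (k # w).
     if (k # w) ! a = i then scal (chi (p i) (drop (Suc a) (k # w))) (single (rem_nth a (k # w))) else 0)"
    by (auto simp: Cons.IH sum_lmul sum.lessThan_Suc_shift rem_nth_def add.commute
        simp del: sum.lessThan_Suc intro!: sum.cong)
  finally show ?case .
qed

text \<open>Only the constant term is kept in the end, so \<open>iter_der p v\<close> sees only the
  component of degree \<open>length v\<close>.\<close>

primrec iter_der :: "(nat \<Rightarrow> nat \<Rightarrow> 'a::field) \<Rightarrow> nat list \<Rightarrow> (nat list \<Rightarrow> 'a) \<Rightarrow> 'a" where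
  "iter_der p [] f = f []"
| "iter_der p (i # v) f = iter_der p v (der p i f)"

lemma iter_der_linear [simp]:
  "iter_der p v (f + g) = iter_der p v f + iter_der p v g"
  "iter_der p v (f - g) = iter_der p v f - iter_der p v g"
  "iter_der p v (scal c f) = c * iter_der p v f"
  "iter_der p v 0 = 0"
proof (induction v arbitrary: f g)
  case Nil
  { case 1 show ?case by simp next case 2 show ?case by simp
    next case 3 show ?case by (simp add: scal_def) next case 4 show ?case by simp }
qed simp_all

lemma iter_der_sum: "iter_der p v (\<Sum>a\<in>A. f a) = (\<Sum>a\<in>A. iter_der p v (f a))"
  using sum_comp_morphism[of "iter_der p v" f A] by (simp add: comp_def)

lemma iter_der_hcomp: "iter_der p v (hcomp m f) = (if length v = m then iter_der p v f else 0)"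
proof (induction v arbitrary: m f)
  case Nil
  then show ?case by (simp add: hcomp_def)
next
  case (Cons i v)
  then show ?case by (cases m) auto
qed

lemma hcomp_single: "hcomp m (single w) = (if length w = m then single w else 0)"
  by (auto simp: hcomp_def single_def fun_eq_iff)

text \<open>Both sides satisfy the same recursion. The reversal arises because
  \<open>symm_word_snoc\<close> strips the last letter of the target word while
  \<open>iter_der\<close> consumes the first letter of \<open>v\<close>.\<close>

lemma symm_word_rev: "symm_word p w (rev v) = iter_der p v (single w)"
proof (induction v arbitrary: w)
  case Nil
  show ?case by (cases w) (auto simp: symm_word_alt single_def inversions_def)
next
  case (Cons i v)
  then show ?case
    by (auto simp: symm_word_snoc der_single iter_der_sum if_distrib intro!: sum.cong)
qed

lemma sum_single:
  fixes f :: "nat list \<Rightarrow> 'a::field"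
  assumes "finite (supp f)"
  shows "(\<Sum>w\<in>supp f. scal (f w) (single w)) = f"
proof
  fix x
  have "(\<Sum>w\<in>supp f. scal (f w) (single w)) x = (\<Sum>w\<in>supp f. if w = x then f w else 0)"
    by (auto simp: sum_fun_apply scal_def single_def intro!: sum.cong)
  then show "(\<Sum>w\<in>supp f. scal (f w) (single w)) x = f x"
    using assms by (simp add: supp_def)
qed

lemma symm_hcomp:
  assumes "finite (supp f)"
  shows "symm p m (hcomp m f) v = (if length v = m then iter_der p (rev v) f else 0)"
proof -
  have "symm p m (hcomp m f) v = (\<Sum>w | w \<in> supp f \<and> length w = m. f w * iter_der p (rev v) (single w))"
    using symm_word_rev[of p _ "rev v"]
    by (auto simp: symm_def sum_fun_apply scal_def hcomp_def supp_def intro!: sum.cong)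
  also have "\<dots> = (\<Sum>w\<in>supp f. f w * iter_der p (rev v) (hcomp m (single w)))"
    using assms by (simp add: hcomp_single sum.inter_filter if_distrib cong: if_cong)
  also have "\<dots> = (if length v = m then (\<Sum>w\<in>supp f. f w * iter_der p (rev v) (single w)) else 0)"
    by (simp add: iter_der_hcomp)
  also have "(\<Sum>w\<in>supp f. f w * iter_der p (rev v) (single w)) = iter_der p (rev v) f"
    by (subst (3) sum_single[OF assms, symmetric]) (simp add: iter_der_sum)
  finally show ?thesis .
qed

definition der_kernel :: "(nat \<Rightarrow> nat \<Rightarrow> 'a::field) \<Rightarrow> (nat list \<Rightarrow> 'a) set" where
  "der_kernel p = {f. \<forall>v. iter_der p v f = 0}"

text \<open>By \<open>symm_hcomp\<close> the coefficients of the symmetrized degree \<open>m\<close>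
  part are the iterated derivatives along words of length \<open>m\<close>. Lengths 0 and 1 just
  read off the coefficients of the unit and of the letters, which matches the condition on short
  words.\<close>

lemma nichols_ideal_eq: "nichols_ideal n p = tens n \<inter> der_kernel p"
proof (intro equalityI subsetI)
  fix f assume f: "f \<in> nichols_ideal n p"
  then have fin: "finite (supp f)" by (simp add: nichols_ideal_def tens_def)
  have "iter_der p v f = 0" for v
  proof (cases "length v < 2")
    case True
    then consider "v = []" | i where "v = [i]" by (cases v; cases "tl v") auto
    then show ?thesis using f by cases (auto simp: nichols_ideal_def)
  next
    case False
    then have "symm p (length v) (hcomp (length v) f) (rev v) = 0"
      using f by (simp add: nichols_ideal_def)
    then show ?thesis by (simp add: symm_hcomp[OF fin])
  qed
  then show "f \<in> tens n \<inter> der_kernel p" using f by (simp add: nichols_ideal_def der_kernel_def)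
next
  fix f assume f: "f \<in> tens n \<inter> der_kernel p"
  then have fin: "finite (supp f)" and 0: "iter_der p v f = 0" for v
    by (auto simp: tens_def der_kernel_def)
  have "f w = 0" if "length w < 2" for w
  proof -
    from that consider "w = []" | i where "w = [i]" by (cases w; cases "tl w") auto
    then show ?thesis using 0[of "[]"] 0[of "[_]"] by cases auto
  qed
  then show "f \<in> nichols_ideal n p"
    using f by (simp add: nichols_ideal_def fun_eq_iff symm_hcomp[OF fin] 0)
qed

lemma subspace_der_kernel: "tv.subspace (der_kernel p)"
  by (auto simp: tv.subspace_def der_kernel_def)

lemma der_kernel_iff: "f \<in> der_kernel p \<longleftrightarrow> f [] = 0 \<and> (\<forall>i. der p i f \<in> der_kernel p)"
proof
  assume f: "f \<in> der_kernel p"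
  then have "iter_der p [] f = 0" "iter_der p (i # v) f = 0" for i v
    unfolding der_kernel_def by blast+
  then show "f [] = 0 \<and> (\<forall>i. der p i f \<in> der_kernel p)" by (simp add: der_kernel_def)
next
  assume f: "f [] = 0 \<and> (\<forall>i. der p i f \<in> der_kernel p)"
  have "iter_der p v f = 0" for v using f by (cases v) (auto simp: der_kernel_def)
  then show "f \<in> der_kernel p" by (simp add: der_kernel_def)
qed

lemma hcomp_der_kernel: "f \<in> der_kernel p \<Longrightarrow> hcomp m f \<in> der_kernel p"
  by (simp add: der_kernel_def iter_der_hcomp)

text \<open>The twist changes an iterated derivative along \<open>v\<close> only by the scalar
  \<open>chi c v\<close>.\<close>

lemma wt_der_kernel: 
  assumes "f \<in> der_kernel p" shows "wt c f \<in> der_kernel p"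
proof -
  have "iter_der p v (wt c f) = chi c v * iter_der p v f" for v
    by (induction v arbitrary: f) (auto simp: wt_def[of _ _ "[]"] der_wt)
  with assms show ?thesis by (simp add: der_kernel_def)
qed

text \<open>By the Leibniz rule each derivative is again a left multiple of a kernel element, plus
  possibly a twist of one. Together with \<open>rmul_der_kernel\<close> this makes the kernel stable
  under multiplication by letters on both sides.\<close>

lemma lmul_der_kernel:
  assumes "f \<in> der_kernel p" shows "lmul j f \<in> der_kernel p"
proof -
  have "iter_der p v (lmul j f) = 0" if "f \<in> der_kernel p" for v f using that
  proof (induction v arbitrary: f)
    case (Cons i v)
    have "iter_der p v (lmul j (der p i f)) = 0" using Cons der_kernel_iff by blast
    moreover have "iter_der p v (wt (p i) f) = 0"
      using wt_der_kernel[OF Cons.prems] by (simp add: der_kernel_def)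
    ultimately show ?case by (auto simp: der_lmul)
  qed simp
  with assms show ?thesis by (simp add: der_kernel_def)
qed

lemma rmul_der_kernel:
  assumes "f \<in> der_kernel p" shows "rmul j f \<in> der_kernel p"
proof -
  have "iter_der p v (rmul j f) = 0" if "f \<in> der_kernel p" for v f using that
  proof (induction v arbitrary: f)
    case (Cons i v)
    have "iter_der p v (rmul j (der p i f)) = 0" using Cons der_kernel_iff by blast
    moreover have "iter_der p v f = 0" using Cons.prems by (simp add: der_kernel_def)
    ultimately show ?case by (simp add: der_rmul)
  qed simp
  with assms show ?thesis by (simp add: der_kernel_def)
qed

section \<open>Iterated brackets of letters\<close>

lemma tens_single: "set w \<subseteq> {..<n} \<Longrightarrow> single w \<in> tens n"
  by (auto simp: tens_def single_def supp_def)

lemma finite_supp_tens: "f \<in> tens n \<Longrightarrow> finite (supp f)"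
  by (simp add: tens_def)

lemma subspace_tens: "tv.subspace (tens n :: (nat list \<Rightarrow> 'a::field) set)"
proof (rule tv.subspaceI)
  show "0 \<in> tens n" by (simp add: tens_def supp_def)
next
  fix f g :: "nat list \<Rightarrow> 'a" assume f: "f \<in> tens n" and g: "g \<in> tens n"
  have *: "f w \<noteq> 0 \<or> g w \<noteq> 0" if "(f + g) w \<noteq> 0" for w using that by auto
  then have "supp (f + g) \<subseteq> supp f \<union> supp g" unfolding supp_def by blast
  moreover have "finite (supp f \<union> supp g)" using f g by (simp add: tens_def)
  ultimately have "finite (supp (f + g))" by (rule finite_subset)
  moreover have "set w \<subseteq> {..<n}" if "(f + g) w \<noteq> 0" for w
    using *[OF that] f g unfolding tens_def by blast
  ultimately show "f + g \<in> tens n" unfolding tens_def by blast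
next
  fix c and f :: "nat list \<Rightarrow> 'a" assume f: "f \<in> tens n"
  have "finite (supp (scal c f))"
    by (rule finite_subset[of _ "supp f"]) (use f in \<open>auto simp: tens_def supp_def scal_def\<close>)
  then show "scal c f \<in> tens n" using f by (simp add: tens_def scal_def)
qed

lemma lmul_tens: "i < n \<Longrightarrow> f \<in> tens n \<Longrightarrow> lmul i f \<in> tens n"
proof -
  assume i: "i < n" and f: "f \<in> tens n"
  have app: "\<exists>u. w = i # u \<and> f u \<noteq> 0" if "lmul i f w \<noteq> 0" for w
    using that by (cases w) (auto split: if_splits)
  then have "supp (lmul i f) \<subseteq> Cons i ` supp f"
    by (auto simp: supp_def)
  then have "finite (supp (lmul i f))"
    using f by (auto simp: tens_def intro: finite_subset)
  then show ?thesis using i f app by (fastforce simp: tens_def)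
qed

lemma rmul_tens: "i < n \<Longrightarrow> f \<in> tens n \<Longrightarrow> rmul i f \<in> tens n"
proof -
  assume i: "i < n" and f: "f \<in> tens n"
  have app: "\<exists>u. w = u @ [i] \<and> f u \<noteq> 0" if "rmul i f w \<noteq> 0" for w
    using that by (cases w rule: rev_cases) (auto split: if_splits)
  then have "supp (rmul i f) \<subseteq> (\<lambda>u. u @ [i]) ` supp f"
    by (auto simp: supp_def)
  then have "finite (supp (rmul i f))"
    using f by (auto simp: tens_def intro: finite_subset)
  then show ?thesis using i f app by (fastforce simp: tens_def)
qed

lemma wt_tens: "f \<in> tens n \<Longrightarrow> wt c f \<in> tens n"
  for f :: "nat list \<Rightarrow> 'a::field"
  by (auto simp: tens_def supp_def wt_def elim!: rev_finite_subset)

lemma subspace_nichols_ideal: "tv.subspace (nichols_ideal n p)"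
  by (simp add: nichols_ideal_eq tv.subspace_inter subspace_tens subspace_der_kernel)

text \<open>Left and right multiplication by a letter in the product
  \<open>u * v = pw s u v (u @ v)\<close>, whose commutator is \<open>bracketR s\<close>.\<close>
definition tlmul :: "(nat \<Rightarrow> nat \<Rightarrow> 'a::field) \<Rightarrow> nat \<Rightarrow> (nat list \<Rightarrow> 'a) \<Rightarrow> nat list \<Rightarrow> 'a" where
  "tlmul s i f = lmul i (wt (s i) f)"

definition trmul :: "(nat \<Rightarrow> nat \<Rightarrow> 'a::field) \<Rightarrow> nat \<Rightarrow> (nat list \<Rightarrow> 'a) \<Rightarrow> nat list \<Rightarrow> 'a" where
  "trmul s j f = rmul j (wt (\<lambda>k. s k j) f)"

lemma module_homI:
  fixes T :: "(nat list \<Rightarrow> 'a::field) \<Rightarrow> nat list \<Rightarrow> 'a"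
  assumes "\<And>f g. T (f + g) = T f + T g" "\<And>c f. T (scal c f) = scal c (T f)"
  shows "module_hom scal scal T"
  using assms tv.module_axioms by (simp add: module_hom_def module_hom_axioms_def)

lemma module_hom_tlmul: "module_hom scal scal (tlmul s i)"
  by (rule module_homI) (simp_all add: tlmul_def)

text \<open>Associativity of the twisted product, for two outer letters: the factor
  \<open>s i j\<close> between them appears in either order of multiplication.\<close>

lemma tlmul_trmul: "tlmul s i (trmul s j f) = trmul s j (tlmul s i f)"
  by (simp add: tlmul_def trmul_def wt_lmul wt_rmul lmul_rmul wt_wt)

lemma tlmul_ideal: "i < n \<Longrightarrow> f \<in> nichols_ideal n p \<Longrightarrow> tlmul s i f \<in> nichols_ideal n p"
  by (simp add: nichols_ideal_eq tlmul_def lmul_tens wt_tens lmul_der_kernel wt_der_kernel)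

lemma trmul_ideal: "i < n \<Longrightarrow> f \<in> nichols_ideal n p \<Longrightarrow> trmul s i f \<in> nichols_ideal n p"
  by (simp add: nichols_ideal_eq trmul_def rmul_tens wt_tens rmul_der_kernel wt_der_kernel)

lemma tlmul_tens: "i < n \<Longrightarrow> f \<in> tens n \<Longrightarrow> tlmul s i f \<in> tens n"
  by (simp add: tlmul_def lmul_tens wt_tens)

text \<open>Commuting with right multiplications makes \<open>T\<close> the left multiplication by
  \<open>T (single [])\<close> in the twisted algebra, and the ideal absorbs right factors. Since
  \<open>s\<close> does not vanish, every word is a scalar multiple of the twisted product of its
  letters.\<close>

lemma ideal_of_unit:
  fixes s :: "nat \<Rightarrow> nat \<Rightarrow> 'a::field"
  assumes T: "module_hom scal scal T" and comm: "\<And>j f. j < n \<Longrightarrow> T (trmul s j f) = trmul s j (T f)"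
    and unit: "T (single []) \<in> nichols_ideal n p"
    and s: "\<And>i j. i < n \<Longrightarrow> j < n \<Longrightarrow> s i j \<noteq> 0"
    and f: "f \<in> tens n"
  shows "T f \<in> nichols_ideal n p"
proof -
  interpret module_hom scal scal T by (fact T)
  have single: "T (single u) \<in> nichols_ideal n p" if "set u \<subseteq> {..<n}" for u
    using that
  proof (induction u rule: rev_induct)
    case (snoc j u)
    have "chi (\<lambda>k. s k j) u \<noteq> 0" using snoc.prems by (induction u) (auto simp: s)
    then have "single (u @ [j]) = scal (inverse (chi (\<lambda>k. s k j) u)) (trmul s j (single u))"
      by (simp add: trmul_def)
    then have "T (single (u @ [j])) = scal (inverse (chi (\<lambda>k. s k j) u)) (trmul s j (T (single u)))"
      using snoc.prems by (simp add: scale comm)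
    then show ?case
      using snoc by (simp add: trmul_ideal tv.subspace_scale[OF subspace_nichols_ideal])
  qed (simp add: unit)
  have "T f = (\<Sum>w\<in>supp f. scal (f w) (T (single w)))"
    using f by (subst sum_single[of f, symmetric]) (simp_all add: tens_def sum scale)
  also have "\<dots> \<in> nichols_ideal n p"
    using f by (intro tv.subspace_sum subspace_nichols_ideal tv.subspace_scale single)
      (auto simp: tens_def supp_def)
  finally show ?thesis .
qed

text \<open>Left multiplication by the right-nested bracket of the letters of \<open>w\<close>.
  Working with operators turns brackets into commutators of operators. The empty word gets the zero
  operator as a default.\<close>

fun ad_op :: "(nat \<Rightarrow> nat \<Rightarrow> 'a::field) \<Rightarrow> nat list \<Rightarrow> (nat list \<Rightarrow> 'a) \<Rightarrow> nat list \<Rightarrow> 'a" where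
  "ad_op s [] f = 0"
| "ad_op s [i] f = tlmul s i f"
| "ad_op s (i # j # w) f = tlmul s i (ad_op s (j # w) f) - ad_op s (j # w) (tlmul s i f)"

lemma ad_op_Cons:
  "w \<noteq> [] \<Longrightarrow> ad_op s (i # w) f = tlmul s i (ad_op s w f) - ad_op s w (tlmul s i f)"
  by (cases w) auto

lemma ad_op_induct [case_names Nil single Cons]:
  assumes "P []" "\<And>i. P [i]" "\<And>i w. w \<noteq> [] \<Longrightarrow> P w \<Longrightarrow> P (i # w)"
  shows "P w"
proof (induction w)
  case (Cons i w)
  then show ?case by (cases "w = []") (auto intro: assms)
qed (rule assms)

lemma tlmul_linear [simp]:
  "tlmul s i (f + g) = tlmul s i f + tlmul s i g"
  "tlmul s i (f - g) = tlmul s i f - tlmul s i g"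
  "tlmul s i (scal c f) = scal c (tlmul s i f)"
  "tlmul s i 0 = 0"
  by (simp_all add: tlmul_def)

lemma trmul_diff: "trmul s i (f - g) = trmul s i f - trmul s i g" "trmul s i 0 = 0"
  by (simp_all add: trmul_def)

lemma module_hom_ad_op: "module_hom scal scal (ad_op s w)"
proof (rule module_homI)
  show "ad_op s w (f + g) = ad_op s w f + ad_op s w g" for f g
    by (induction w arbitrary: f g rule: ad_op_induct) (simp_all add: ad_op_Cons)
  show "ad_op s w (scal c f) = scal c (ad_op s w f)" for c f
    by (induction w arbitrary: f rule: ad_op_induct)
      (simp_all add: ad_op_Cons tv.scale_right_diff_distrib)
qed

lemma ad_op_trmul: "ad_op s w (trmul s j f) = trmul s j (ad_op s w f)"
  by (induction w arbitrary: f rule: ad_op_induct)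
    (simp_all add: ad_op_Cons tlmul_trmul trmul_diff)

lemma ad_op_closed:
  assumes "tv.subspace J" "\<And>i f. i \<in> set w \<Longrightarrow> f \<in> J \<Longrightarrow> tlmul s i f \<in> J" "f \<in> J"
  shows "ad_op s w f \<in> J"
  using assms(2,3)
  by (induction w arbitrary: f rule: ad_op_induct)
    (simp_all add: ad_op_Cons tv.subspace_0[OF assms(1)] tv.subspace_diff[OF assms(1)])

lemma ad_op_tens: "set w \<subseteq> {..<n} \<Longrightarrow> f \<in> tens n \<Longrightarrow> ad_op s w f \<in> tens n"
  by (rule ad_op_closed[OF subspace_tens]) (auto intro: tlmul_tens)

lemma hcomp_linear [simp]:
  fixes f g :: "nat list \<Rightarrow> 'a::field"
  shows "hcomp m (f + g) = hcomp m f + hcomp m g" "hcomp m (f - g) = hcomp m f - hcomp m g"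
    "hcomp m (scal c f) = scal c (hcomp m f)" "hcomp m 0 = (0 :: nat list \<Rightarrow> 'a)"
  by (auto simp: fun_eq_iff hcomp_def scal_def)

lemma hcomp_tlmul: "hcomp (Suc m) (tlmul s i f) = tlmul s i (hcomp m f)"
  by (auto simp: fun_eq_iff hcomp_def tlmul_def lmul_def wt_def split: list.splits)

lemma hcomp_ad_op: "hcomp (m + length w) (ad_op s w f) = ad_op s w (hcomp m f)"
proof (induction w arbitrary: m f rule: ad_op_induct)
  case (Cons i w)
  show ?case
    using Cons.IH[of m f] Cons.IH[of "Suc m" "tlmul s i f"]
    unfolding ad_op_Cons[OF Cons.hyps] hcomp_linear by (simp add: hcomp_tlmul)
qed (simp_all add: hcomp_tlmul)

lemma hcomp_ad_op_unit: "hcomp (length w) (ad_op s w (single [])) = ad_op s w (single [])"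
  for s :: "nat \<Rightarrow> nat \<Rightarrow> 'a::field"
proof -
  have "hcomp 0 (single []) = (single [] :: nat list \<Rightarrow> 'a)" by (simp add: hcomp_single)
  from hcomp_ad_op[of 0 w s "single []", unfolded add_0 this] show ?thesis .
qed

lemma hcomp_ideal: "f \<in> nichols_ideal n p \<Longrightarrow> hcomp m f \<in> nichols_ideal n p"
proof -
  assume f: "f \<in> nichols_ideal n p"
  then have "finite (supp f)" by (simp add: nichols_ideal_eq tens_def)
  moreover have "supp (hcomp m f) \<subseteq> supp f" by (auto simp: supp_def hcomp_def)
  ultimately have "finite (supp (hcomp m f))" by (rule rev_finite_subset)
  moreover have "\<forall>w. hcomp m f w \<noteq> 0 \<longrightarrow> set w \<subseteq> {..<n}"
    using f by (simp add: nichols_ideal_eq tens_def hcomp_def)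
  ultimately show ?thesis
    using f hcomp_der_kernel[of f p m] by (simp add: nichols_ideal_eq tens_def)
qed

lemma pw_single: "pw s [i] v = chi (s i) v" "pw s v [i] = chi (\<lambda>k. s k i) v"
  by (simp_all add: pw_def chi_conv_prod)

lemma supp_single [simp]: "supp (single w :: nat list \<Rightarrow> 'a::field) = {w}"
  by (auto simp: supp_def single_def)

lemma single_self: "single w w = 1"
  by (simp add: single_def)

lemma bracketR_letter:
  fixes g :: "nat list \<Rightarrow> 'a::field"
  assumes "finite (supp g)"
  shows "bracketR s (single [i]) g = tlmul s i g - trmul s i g"
proof -
  have "trmul s i g = (\<Sum>v\<in>supp g. scal (g v) (trmul s i (single v)))"
    using sum_comp_morphism[of "trmul s i" "\<lambda>v. scal (g v) (single v)" "supp g"]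
    by (simp add: trmul_def sum_single[OF assms] comp_def)
  moreover have "tlmul s i g = (\<Sum>v\<in>supp g. scal (g v) (tlmul s i (single v)))"
    using sum_comp_morphism[of "tlmul s i" "\<lambda>v. scal (g v) (single v)" "supp g"]
    by (simp add: sum_single[OF assms] comp_def)
  ultimately show ?thesis
    by (simp add: bracketR_def single_self pw_single tlmul_def trmul_def sum_subtractf[symmetric]
        tv.scale_right_diff_distrib)
qed

text \<open>Applied to the unit, the operator returns the bracket itself: left and right
  multiplication by \<open>i\<close> agree on the unit, and \<open>ad_op s w\<close> commutes with
  the right one, so the operator commutator becomes the bracket with the letter
  \<open>i\<close>.\<close>

lemma ad_op_lie_gen:
  assumes "w \<noteq> []" "set w \<subseteq> {..<n}"
  shows "ad_op s w (single []) \<in> lie_gen n (bracketR s)"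
  using assms
proof (induction w rule: ad_op_induct)
  case (single i)
  then show ?case by (simp add: tlmul_def lie_gen.gen)
next
  case (Cons i w)
  have "finite (supp (ad_op s w (single [])))"
    using Cons.prems by (intro finite_supp_tens[of _ n] ad_op_tens tens_single) auto
  moreover have "tlmul s i (single []) = trmul s i (single [])" by (simp add: tlmul_def trmul_def)
  ultimately have "ad_op s (i # w) (single []) = bracketR s (single [i]) (ad_op s w (single []))"
    using Cons.hyps by (simp add: ad_op_Cons ad_op_trmul bracketR_letter)
  then show ?case using Cons by (simp add: lie_gen.br lie_gen.gen)
qed simp

text \<open>Homogeneous elements of distinct degrees outside a graded subspace are independent
  modulo it, so finite dimension bounds their number. The independence is transferred to
  representatives in the span of a finite set.\<close>

lemma finite_degrees_of_fin_dim:
  fixes F :: "nat \<Rightarrow> nat list \<Rightarrow> 'a::field"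
  assumes K: "tv.subspace K" "\<And>m f. f \<in> K \<Longrightarrow> hcomp m f \<in> K"
    and fd: "fin_dim_mod S K"
    and F: "\<And>m. m \<in> M \<Longrightarrow> F m \<in> S - K" "\<And>m. m \<in> M \<Longrightarrow> hcomp m (F m) = F m"
  shows "finite M"
proof -
  obtain B where B: "finite B" "\<And>f. f \<in> S \<Longrightarrow> \<exists>c. f - (\<Sum>b\<in>B. scal (c b) b) \<in> K"
    using fd by (auto simp: fin_dim_mod_def)
  have "\<exists>g. g \<in> tv.span B \<and> F m - g \<in> K" if m: "m \<in> M" for m
  proof -
    obtain c where "F m - (\<Sum>b\<in>B. scal (c b) b) \<in> K" using B(2)[of "F m"] F(1)[OF m] by auto
    moreover have "(\<Sum>b\<in>B. scal (c b) b) \<in> tv.span B"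
      by (intro tv.span_sum tv.span_scale tv.span_base)
    ultimately show ?thesis by blast
  qed
  then have "\<forall>m\<in>M. \<exists>g. g \<in> tv.span B \<and> F m - g \<in> K" by blast
  from bchoice[OF this] obtain G
    where "\<forall>m\<in>M. G m \<in> tv.span B \<and> F m - G m \<in> K" by blast
  then have G: "\<And>m. m \<in> M \<Longrightarrow> G m \<in> tv.span B" "\<And>m. m \<in> M \<Longrightarrow> F m - G m \<in> K" by auto
  \<comment> \<open>A relation among the \<open>G m\<close> puts the same combination of the
    \<open>F m\<close> into \<open>K\<close>; its degree \<open>m\<close> component is
    \<open>scal (u m) (F m)\<close>, which would put \<open>F m\<close> into
    \<open>K\<close>.\<close>
  have indep: "u m = 0" if T: "finite T" "T \<subseteq> M" "m \<in> T" and u: "(\<Sum>m\<in>T. scal (u m) (G m)) = 0" for T u m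
  proof (rule ccontr)
    assume "u m \<noteq> 0"
    have "(\<Sum>m\<in>T. scal (u m) (F m)) = (\<Sum>m\<in>T. scal (u m) (F m - G m))"
      using u by (simp add: tv.scale_right_diff_distrib sum_subtractf)
    also have "\<dots> \<in> K" using T G by (intro tv.subspace_sum[OF K(1)] tv.subspace_scale[OF K(1)]) auto
    finally have "hcomp m (\<Sum>m\<in>T. scal (u m) (F m)) \<in> K" by (rule K(2))
    also have "hcomp m (\<Sum>k\<in>T. scal (u k) (F k)) = (\<Sum>k\<in>T. scal (u k) (hcomp m (F k)))"
      using sum_comp_morphism[of "hcomp m" "\<lambda>k. scal (u k) (F k)" T] by (simp add: comp_def)
    also have "\<dots> = (\<Sum>k\<in>T. if k = m then scal (u m) (F m) else 0)"
    proof (rule sum.cong[OF refl])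
      fix k assume "k \<in> T"
      then have "hcomp k (F k) = F k" using T F(2) by auto
      moreover have "hcomp m (hcomp k f) = (if k = m then hcomp k f else 0)" for f :: "nat list \<Rightarrow> 'a"
        by (auto simp: hcomp_def fun_eq_iff)
      ultimately show "scal (u k) (hcomp m (F k)) = (if k = m then scal (u m) (F m) else 0)"
        by (metis tv.scale_zero_right)
    qed
    also have "\<dots> = scal (u m) (F m)" using T by simp
    finally have "scal (inverse (u m)) (scal (u m) (F m)) \<in> K" by (rule tv.subspace_scale[OF K(1)])
    then have "F m \<in> K" using \<open>u m \<noteq> 0\<close> by simp
    then show False using F(1) T by blast
  qed
  have inj: "inj_on G M"
  proof (rule inj_onI, rule ccontr)
    fix k l assume kl: "k \<in> M" "l \<in> M" "G k = G l" "k \<noteq> l"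
    \<comment> \<open>Equal representatives in different degrees would give a relation with
      coefficients 1 and -1.\<close>
    have "(if k = k then 1 else - 1 :: 'a) = 0"
      by (rule indep[of "{k, l}" k "\<lambda>x. if x = k then 1 else - 1"]) (use kl in auto)
    then show False by simp
  qed
  have "tv.independent (G ` M)"
  proof
    assume "tv.dependent (G ` M)"
    then obtain U u where U: "finite U" "U \<subseteq> G ` M" "\<exists>v\<in>U. u v \<noteq> 0" "(\<Sum>v\<in>U. scal (u v) v) = 0"
      unfolding tv.dependent_explicit by blast
    obtain T where T: "T \<subseteq> M" "U = G ` T" using U(2) by (meson subset_imageE)
    have injT: "inj_on G T" using inj T(1) by (rule inj_on_subset)
    have "finite T" using U(1) T(2) injT by (simp add: finite_image_iff)
    moreover have "(\<Sum>m\<in>T. scal (u (G m)) (G m)) = 0"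
      using U(4) T(2) by (simp add: sum.reindex[OF injT])
    ultimately have "u (G m) = 0" if "m \<in> T" for m
      using indep[of T m "\<lambda>m. u (G m)"] T(1) that by blast
    then show False using U(3) T(2) by auto
  qed
  moreover have "G ` M \<subseteq> tv.span B" using G(1) by auto
  ultimately have "finite (G ` M)" using tv.independent_span_bound[OF B(1)] by blast
  then show ?thesis using inj by (simp add: finite_image_iff)
qed

lemma ad_op_eventually_ideal:
  fixes p s :: "nat \<Rightarrow> nat \<Rightarrow> 'a::field"
  assumes fd: "fin_dim_mod (lie_gen n (bracketR s)) (nichols_ideal n p)"
    and s: "\<And>i j. i < n \<Longrightarrow> j < n \<Longrightarrow> s i j \<noteq> 0"
  obtains N where "\<And>w (f :: nat list \<Rightarrow> 'a). set w \<subseteq> {..<n} \<Longrightarrow> N < length w \<Longrightarrow> f \<in> tens n \<Longrightarrow>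
    ad_op s w f \<in> nichols_ideal n p"
proof -
  let ?P = "\<lambda>m w. length w = m \<and> w \<noteq> [] \<and> set w \<subseteq> {..<n} \<and> ad_op s w (single []) \<notin> nichols_ideal n p"
  \<comment> \<open>The degrees in which some iterated bracket survives modulo the ideal;
    \<open>W\<close> picks one surviving word per degree.\<close>
  define M where "M = {m. \<exists>w. ?P m w}"
  define W where "W m = (SOME w. ?P m w)" for m
  have W: "?P m (W m)" if "m \<in> M" for m
    using that unfolding M_def W_def mem_Collect_eq by (rule someI_ex)
  have "finite M"
  proof (rule finite_degrees_of_fin_dim[OF subspace_nichols_ideal hcomp_ideal fd])
    fix m assume m: "m \<in> M"
    show "ad_op s (W m) (single []) \<in> lie_gen n (bracketR s) - nichols_ideal n p"
      using W[OF m] by (simp add: ad_op_lie_gen)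
    show "hcomp m (ad_op s (W m) (single [])) = ad_op s (W m) (single [])"
      using W[OF m] hcomp_ad_op_unit[of "W m" s] by simp
  qed
  then obtain N where N: "\<forall>m\<in>M. m \<le> N" unfolding finite_nat_set_iff_bounded_le by (elim exE)
  show ?thesis
  proof
    fix w and f :: "nat list \<Rightarrow> 'a"
    assume w: "set w \<subseteq> {..<n}" "N < length w" and f: "f \<in> tens n"
    have "length w \<notin> M" using N w(2) by fastforce
    then have "ad_op s w (single []) \<in> nichols_ideal n p" using w by (auto simp: M_def)
    then show "ad_op s w f \<in> nichols_ideal n p"
      by (intro ideal_of_unit[OF module_hom_ad_op ad_op_trmul _ _ f]) (simp_all add: s)
  qed
qed

section \<open>Nilpotency of the letters\<close>

lemma ad_op_unit_Cons:
  assumes "w \<noteq> []"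
  shows "ad_op s (i # w) (single []) =
    tlmul s i (ad_op s w (single [])) - trmul s i (ad_op s w (single []))"
proof -
  have "tlmul s i (single []) = trmul s i (single [])" by (simp add: tlmul_def trmul_def)
  with assms show ?thesis by (simp add: ad_op_Cons ad_op_trmul)
qed

text \<open>Up to a scalar, the iterated bracket of \<open>m\<close> letters \<open>i\<close> with the letter \<open>j\<close>.\<close>
primrec iter_br :: "'a::field \<Rightarrow> nat \<Rightarrow> nat \<Rightarrow> nat \<Rightarrow> nat list \<Rightarrow> 'a" where
  "iter_br r i j 0 = single [j]"
| "iter_br r i j (Suc m) = lmul i (iter_br r i j m) - scal r (rmul i (iter_br r i j m))"

lemma wt_iter_br: "wt d (iter_br r i j m) = scal (d i ^ m * d j) (iter_br r i j m)"
  by (induction m) (simp_all add: wt_lmul wt_rmul tv.scale_right_diff_distrib mult_ac del: minus_apply)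

lemma trmul_scal: "trmul s i (scal c f) = scal c (trmul s i f)"
  by (simp add: trmul_def)

text \<open>Every word occurring has \<open>m\<close> letters \<open>i\<close> and one
  \<open>j\<close>, so both twists act as scalars, namely \<open>s i i ^ m * s i j\<close> on the
  left and \<open>s i i ^ m * s j i\<close> on the right. Their ratio is the parameter of
  \<open>iter_br\<close>.\<close>

lemma ad_op_iter_br:
  assumes "s i i \<noteq> 0" "s i j \<noteq> 0"
  shows "\<exists>c. c \<noteq> 0 \<and>
    ad_op s (replicate m i @ [j]) (single []) = scal c (iter_br (s j i / s i j) i j m)"
proof (induction m)
  case 0
  show ?case by (rule exI[of _ 1]) (simp add: tlmul_def)
next
  case (Suc m)
  let ?z = "iter_br (s j i / s i j) i j"
  obtain c where c: "c \<noteq> 0" "ad_op s (replicate m i @ [j]) (single []) = scal c (?z m)"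
    using Suc.IH by blast
  have "tlmul s i (?z m) = scal (s i i ^ m * s i j) (lmul i (?z m))"
    by (simp add: tlmul_def wt_iter_br)
  moreover have "trmul s i (?z m) = scal (s i i ^ m * s i j) (scal (s j i / s i j) (rmul i (?z m)))"
    using assms by (simp add: trmul_def wt_iter_br)
  ultimately have "ad_op s (i # replicate m i @ [j]) (single []) =
      scal (c * (s i i ^ m * s i j)) (?z (Suc m))"
    by (subst ad_op_unit_Cons) (simp_all add: c(2) trmul_scal tv.scale_right_diff_distrib)
  moreover have "c * (s i i ^ m * s i j) \<noteq> 0" using assms c(1) by simp
  ultimately show ?case unfolding replicate_Suc append_Cons by blast
qed

section \<open>Skew derivatives of powers and iterated brackets\<close>

lemma der_single_Nil [simp]: "der p i (single []) = 0"
  by (simp add: der_single)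

lemma lmul_replicate: "lmul i (single (replicate m i)) = (single (replicate (Suc m) i) :: _ \<Rightarrow> 'a::field)"
  by simp

lemma rmul_replicate: "rmul i (single (replicate m i)) = (single (replicate (Suc m) i) :: _ \<Rightarrow> 'a::field)"
  by (simp add: replicate_append_same)

lemma chi_replicate: "chi c (replicate m i) = c i ^ m"
  by (induction m) simp_all

lemma der_replicate:
  "der p k (single (replicate (Suc m) i)) =
     (if k = i then scal (\<Sum>l<Suc m. p i i ^ l) (single (replicate m i)) else 0)"
proof (induction m)
  case 0
  show ?case using der_lmul[of p k i "single []"] by simp
next
  case (Suc m)
  have "der p k (single (replicate (Suc (Suc m)) i)) =
      lmul i (der p k (single (replicate (Suc m) i))) +
      (if k = i then scal (p i i ^ Suc m) (single (replicate (Suc m) i)) else 0)"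
    using der_lmul[of p k i "single (replicate (Suc m) i)"]
    unfolding lmul_replicate wt_single chi_replicate by (auto simp del: replicate_Suc power_Suc)
  also have "\<dots> = (if k = i then scal (\<Sum>l<Suc (Suc m). p i i ^ l) (single (replicate (Suc m) i)) else 0)"
    unfolding Suc.IH sum.lessThan_Suc[of _ "Suc m"] tv.scale_left_distrib
    by (simp add: lmul_replicate del: lmul_single replicate_Suc power_Suc sum.lessThan_Suc)
  finally show ?case .
qed

lemma replicate_der_kernel:
  assumes "(\<Sum>l<N. p i i ^ l) = 0" "N > 0"
  shows "single (replicate N i) \<in> der_kernel p"
proof -
  obtain m where "N = Suc m" using assms(2) by (cases N) auto
  moreover have "der p k (single (replicate (Suc m) i)) \<in> der_kernel p" for k
    using assms unfolding der_replicate \<open>N = Suc m\<close>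
    by (simp add: tv.subspace_0[OF subspace_der_kernel] del: sum.lessThan_Suc)
  ultimately show ?thesis by (subst der_kernel_iff) (simp add: single_def)
qed

text \<open>Derivatives along \<open>i\<close> descend through the powers with nonzero quantum
  integers as factors, down to the unit.\<close>

lemma replicate_notin_der_kernel:
  assumes "\<And>m. m > 0 \<Longrightarrow> (\<Sum>l<m. p i i ^ l) \<noteq> 0"
  shows "single (replicate m i) \<notin> der_kernel p"
proof (induction m)
  case 0
  show ?case by (subst der_kernel_iff) (simp add: single_def)
next
  case (Suc m)
  let ?c = "\<Sum>l<Suc m. p i i ^ l"
  have c: "?c \<noteq> 0" by (rule assms) simp
  show ?case
  proof
    assume "single (replicate (Suc m) i) \<in> der_kernel p"
    then have "der p i (single (replicate (Suc m) i)) \<in> der_kernel p" using der_kernel_iff by blast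
    then have "scal ?c (single (replicate m i)) \<in> der_kernel p" unfolding der_replicate by simp
    then have "scal (inverse ?c) (scal ?c (single (replicate m i))) \<in> der_kernel p"
      by (rule tv.subspace_scale[OF subspace_der_kernel])
    then show False using c Suc.IH by (simp del: sum.lessThan_Suc)
  qed
qed

lemma scal_der_kernelD:
  assumes "scal c f \<in> der_kernel p" "c \<noteq> 0"
  shows "f \<in> der_kernel p"
proof -
  have "scal (inverse c) (scal c f) \<in> der_kernel p"
    by (rule tv.subspace_scale[OF subspace_der_kernel assms(1)])
  with assms(2) show ?thesis by simp
qed

lemma der_letter: "der p k (single [j]) = (if k = j then single [] else 0)"
  using der_lmul[of p k j "single []"] by simp

text \<open>Deleting the only \<open>j\<close> leaves a power of \<open>i\<close>, and each further
  bracket contributes a factor \<open>1 - r * p j i\<close>.\<close>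

lemma der_other_iter_br:
  assumes "i \<noteq> j"
  shows "der p j (iter_br r i j m) = scal ((1 - r * p j i) ^ m) (single (replicate m i))"
proof (induction m)
  case 0
  show ?case by (simp add: der_letter)
next
  case (Suc m)
  have "der p j (iter_br r i j (Suc m)) =
      lmul i (der p j (iter_br r i j m)) - scal (r * p j i) (rmul i (der p j (iter_br r i j m)))"
    using assms by (simp add: der_lmul der_rmul)
  also have "\<dots> = scal ((1 - r * p j i) ^ m) (single (replicate (Suc m) i)) -
      scal (r * p j i) (scal ((1 - r * p j i) ^ m) (single (replicate (Suc m) i)))"
    unfolding Suc.IH lmul_linear rmul_linear lmul_replicate rmul_replicate ..
  also have "\<dots> = scal ((1 - r * p j i) ^ Suc m) (single (replicate (Suc m) i))"
    unfolding tv.scale_scale tv.scale_left_diff_distrib[symmetric] by (simp add: algebra_simps)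
  finally show ?case .
qed

text \<open>In the last term, \<open>p i i ^ m * p i j\<close> is the twist from differentiating the
  new left letter, and \<open>r\<close> comes from the new right letter.\<close>

lemma der_same_iter_br:
  assumes "i \<noteq> j"
  shows "der p i (iter_br r i j (Suc m)) =
    lmul i (der p i (iter_br r i j m)) - scal (r * p i i) (rmul i (der p i (iter_br r i j m)))
    + scal (p i i ^ m * p i j - r) (iter_br r i j m)"
  using assms
  by (simp add: der_lmul der_rmul wt_iter_br tv.scale_right_distrib tv.scale_left_diff_distrib)

text \<open>The derivative along \<open>j\<close> forces \<open>r * p j i = 1\<close>. If
  \<open>p i j\<close> differed from \<open>r\<close>, further derivatives would put the letter
  \<open>j\<close> or a power of \<open>i\<close> into the kernel, depending on whether
  \<open>p i i\<close> is 1.\<close>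

lemma connected_letter_relation:
  fixes p :: "nat \<Rightarrow> nat \<Rightarrow> 'a::field_char_0"
  assumes "i \<noteq> j"
    and nz: "\<And>m. m > 0 \<Longrightarrow> (\<Sum>l<m. p i i ^ l) \<noteq> 0"
    and ker: "iter_br r i j (Suc m) \<in> der_kernel p"
  shows "p i j * p j i = 1"
proof -
  let ?z = "iter_br r i j" and ?q = "p i i" and ?a = "p i j" and ?b = "p j i"
  have der_ker: "der p k f \<in> der_kernel p" if "f \<in> der_kernel p" for k f
    using that der_kernel_iff by blast
  have no: "single (replicate m i) \<notin> der_kernel p" for m
    using nz by (rule replicate_notin_der_kernel)
  have "(1 - r * ?b) ^ Suc m = 0"
    using der_ker[OF ker, of j] no scal_der_kernelD unfolding der_other_iter_br[OF assms(1)] by blast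
  then have rb: "r * ?b = 1" by (simp del: power_Suc)
  have "?a = r"
  proof (rule ccontr)
    assume ar: "?a \<noteq> r"
    show False
    proof (cases "?q = 1")
      case True
      \<comment> \<open>For \<open>p i i = 1\<close> the derivative along \<open>i\<close> lowers
        the bracket by one step; its factor is nonzero in characteristic zero, so the descent ends
        at the letter \<open>j\<close>.\<close>
      have d: "der p i (?z (Suc k)) = scal (of_nat (Suc k) * (?a - r)) (?z k)" for k
      proof (induction k)
        case 0
        show ?case using der_same_iter_br[OF assms(1), of p r 0] assms(1) True
          by (simp add: der_letter del: minus_apply)
      next
        case (Suc k)
        have "der p i (?z (Suc (Suc k))) =
            scal (of_nat (Suc k) * (?a - r)) (lmul i (?z k)) -
            scal (of_nat (Suc k) * (?a - r)) (scal r (rmul i (?z k))) + scal (?a - r) (?z (Suc k))"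
          unfolding der_same_iter_br[OF assms(1), of p r "Suc k"] Suc.IH using True
          by (simp add: mult_ac)
        also have "\<dots> = scal (of_nat (Suc k) * (?a - r)) (?z (Suc k)) + scal (?a - r) (?z (Suc k))"
          by (simp add: tv.scale_right_diff_distrib)
        also have "\<dots> = scal (of_nat (Suc (Suc k)) * (?a - r)) (?z (Suc k))"
          unfolding tv.scale_left_distrib[symmetric] by (simp add: algebra_simps)
        finally show ?case .
      qed
      have "?z k \<in> der_kernel p \<Longrightarrow> False" for k
      proof (induction k)
        case 0
        from der_ker[OF 0, of j] no[of 0] show False by (simp add: der_letter)
      next
        case (Suc k)
        have "of_nat (Suc k) * (?a - r) \<noteq> 0" using ar by (simp del: of_nat_Suc)
        then show False using Suc.IH der_ker[OF Suc.prems, of i] scal_der_kernelD unfolding d by blast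
      qed
      then show False using ker by blast
    next
      case False
      have z: "der p j (?z (Suc k)) = 0" for k
        unfolding der_other_iter_br[OF assms(1)] by (simp add: rb)
      \<comment> \<open>For \<open>p i i \<noteq> 1\<close> one derivative along \<open>i\<close>
        followed by one along \<open>j\<close> suffices: the term with \<open>?z (Suc k)\<close>
        dies by \<open>z\<close>, and the rest gains a factor \<open>1 - ?q\<close> per
        step.\<close>
      have e: "der p j (der p i (?z (Suc k))) = scal ((1 - ?q) ^ k * (?a - r)) (single (replicate k i))" for k
      proof (induction k)
        case 0
        show ?case using der_same_iter_br[OF assms(1), of p r 0] assms(1)
          by (simp add: der_letter del: minus_apply)
      next
        case (Suc k)
        let ?c = "(1 - ?q) ^ k * (?a - r)"
        have "der p j (der p i (?z (Suc (Suc k)))) =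
            lmul i (der p j (der p i (?z (Suc k)))) -
            scal (r * ?q * ?b) (rmul i (der p j (der p i (?z (Suc k)))))"
          unfolding der_same_iter_br[OF assms(1), of p r "Suc k"] der_linear z
          using assms(1) by (simp add: der_lmul der_rmul del: iter_br.simps)
        also have "r * ?q * ?b = ?q" using rb by (simp add: mult_ac)
        also have "lmul i (der p j (der p i (?z (Suc k)))) -
            scal ?q (rmul i (der p j (der p i (?z (Suc k))))) =
            scal ?c (single (replicate (Suc k) i)) - scal ?q (scal ?c (single (replicate (Suc k) i)))"
          unfolding Suc.IH lmul_linear rmul_linear lmul_replicate rmul_replicate ..
        also have "\<dots> = scal ((1 - ?q) ^ Suc k * (?a - r)) (single (replicate (Suc k) i))"
          unfolding tv.scale_scale tv.scale_left_diff_distrib[symmetric] by (simp add: algebra_simps)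
        finally show ?case .
      qed
      have "(1 - ?q) ^ m * (?a - r) \<noteq> 0" using False ar by simp
      moreover have "scal ((1 - ?q) ^ m * (?a - r)) (single (replicate m i)) \<in> der_kernel p"
        using der_ker[OF der_ker[OF ker, of i], of j] unfolding e .
      ultimately show False using no scal_der_kernelD by blast
    qed
  qed
  with rb show ?thesis by simp
qed

lemma module_hom_funpow:
  fixes T :: "(nat list \<Rightarrow> 'a::field) \<Rightarrow> nat list \<Rightarrow> 'a"
  assumes "module_hom scal scal T"
  shows "module_hom scal scal (T ^^ m)"
proof -
  interpret T: module_hom scal scal T by (fact assms)
  show ?thesis
  proof (rule module_homI)
    show "(T ^^ m) (f + g) = (T ^^ m) f + (T ^^ m) g" for f g
      by (induction m) (simp_all add: T.add del: plus_fun_apply)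
    show "(T ^^ m) (scal c f) = scal c ((T ^^ m) f)" for c f
      by (induction m) (simp_all add: T.scale)
  qed
qed

lemma tlmul_funpow_unit: "\<exists>c. (tlmul s i ^^ m) (single []) = scal c (single (replicate m i))"
proof (induction m)
  case 0
  show ?case by (rule exI[of _ 1]) simp
next
  case (Suc m)
  then obtain c where "(tlmul s i ^^ m) (single []) = scal c (single (replicate m i))" by blast
  then have "(tlmul s i ^^ Suc m) (single []) = scal (c * s i i ^ m) (single (replicate (Suc m) i))"
    by (simp add: tlmul_def[of s i "single _"] chi_replicate)
  then show ?case by blast
qed

text \<open>A long bracket of letters \<open>i\<close> with \<open>j\<close> lies in the ideal, so
  some quantum integer of \<open>p i i\<close> vanishes. The corresponding power of \<open>i\<close>
  is then in the ideal, and \<open>ideal_of_unit\<close> passes from the unit to all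
  tensors.\<close>

lemma tlmul_nilpotent:
  fixes p s :: "nat \<Rightarrow> nat \<Rightarrow> 'a::field_char_0"
  assumes fd: "fin_dim_mod (lie_gen n (bracketR s)) (nichols_ideal n p)"
    and s: "\<And>i j. i < n \<Longrightarrow> j < n \<Longrightarrow> s i j \<noteq> 0"
    and ij: "i < n" "j < n" "i \<noteq> j" "p i j * p j i \<noteq> 1"
  shows "\<exists>N. \<forall>f\<in>tens n. (tlmul s i ^^ N) f \<in> nichols_ideal n p"
proof -
  obtain N where N: "\<And>w (f :: nat list \<Rightarrow> 'a). set w \<subseteq> {..<n} \<Longrightarrow> N < length w \<Longrightarrow> f \<in> tens n \<Longrightarrow>
      ad_op s w f \<in> nichols_ideal n p"
    using ad_op_eventually_ideal[OF fd s] by blast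
  let ?w = "replicate (Suc N) i @ [j]"
  have w: "ad_op s ?w (single []) \<in> nichols_ideal n p"
    by (rule N) (use ij in \<open>auto intro: tens_single\<close>)
  obtain c where "c \<noteq> 0" "ad_op s ?w (single []) = scal c (iter_br (s j i / s i j) i j (Suc N))"
    using ad_op_iter_br[of s i j "Suc N"] s ij by blast
  with w have "iter_br (s j i / s i j) i j (Suc N) \<in> der_kernel p"
    unfolding nichols_ideal_eq using scal_der_kernelD by (metis Int_iff)
  then obtain M where M: "M > 0" "(\<Sum>l<M. p i i ^ l) = 0"
    using connected_letter_relation[OF ij(3)] ij(4) by blast
  obtain d where d: "(tlmul s i ^^ M) (single []) = scal d (single (replicate M i))"
    using tlmul_funpow_unit by blast
  have "single (replicate M i) \<in> nichols_ideal n p"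
    using replicate_der_kernel[where p = p and i = i, OF M(2,1)] ij(1) by (auto simp: nichols_ideal_eq intro: tens_single)
  then have unit: "(tlmul s i ^^ M) (single []) \<in> nichols_ideal n p"
    unfolding d by (rule tv.subspace_scale[OF subspace_nichols_ideal])
  have comm: "(tlmul s i ^^ M) (trmul s j f) = trmul s j ((tlmul s i ^^ M) f)" for j f
    by (induction M) (simp_all add: tlmul_trmul)
  show ?thesis
    using ideal_of_unit[OF module_hom_funpow[OF module_hom_tlmul] comm unit s] by blast
qed

section \<open>Dividing out central nilpotent brackets\<close>

text \<open>Modulo \<open>J\<close>, commuting with \<open>Z\<close> acts as a derivation that
  replaces a factor \<open>X\<close> by \<open>C\<close>, and \<open>C\<close> commutes with
  \<open>X\<close> and \<open>Z\<close>. Starting from \<open>X ^^ N\<close>, repeated use replaces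
  all factors; the integers that appear are invertible in characteristic zero.\<close>

lemma commutator_nilpotent:
  fixes X Z C :: "(nat list \<Rightarrow> 'a::field_char_0) \<Rightarrow> nat list \<Rightarrow> 'a"
  assumes J: "tv.subspace J"
    and hom: "module_hom scal scal X" "module_hom scal scal Z" "module_hom scal scal C"
    and XT: "\<And>f. f \<in> T \<Longrightarrow> X f \<in> T" and ZT: "\<And>f. f \<in> T \<Longrightarrow> Z f \<in> T"
    and CT: "\<And>f. f \<in> T \<Longrightarrow> C f \<in> T"
    and XJ: "\<And>f. f \<in> J \<Longrightarrow> X f \<in> J" and ZJ: "\<And>f. f \<in> J \<Longrightarrow> Z f \<in> J"
    and CJ: "\<And>f. f \<in> J \<Longrightarrow> C f \<in> J"
    and C: "\<And>f. C f = X (Z f) - Z (X f)"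
    and CX: "\<And>f. f \<in> T \<Longrightarrow> C (X f) - X (C f) \<in> J"
    and CZ: "\<And>f. f \<in> T \<Longrightarrow> C (Z f) - Z (C f) \<in> J"
    and nil: "\<And>f. f \<in> T \<Longrightarrow> (X ^^ N) f \<in> J"
    and f: "f \<in> T"
  shows "(C ^^ N) f \<in> J"
proof -
  interpret X: module_hom scal scal X by (fact hom)
  interpret Z: module_hom scal scal Z by (fact hom)
  interpret C: module_hom scal scal C by (fact hom)
  note closed = tv.subspace_add[OF J] tv.subspace_diff[OF J] tv.subspace_scale[OF J]
  have XpT: "(X ^^ m) f \<in> T" if "f \<in> T" for m f using that by (induction m) (auto simp: XT)
  have CpT: "(C ^^ m) f \<in> T" if "f \<in> T" for m f using that by (induction m) (auto simp: CT)
  have CpJ: "(C ^^ m) f \<in> J" if "f \<in> J" for m f using that by (induction m) (auto simp: CJ)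
  \<comment> \<open>\<open>X\<^sup>m\<^sup>+\<^sup>1 Z - Z X\<^sup>m\<^sup>+\<^sup>1\<close> is congruent to \<open>(m + 1) C X\<^sup>m\<close> modulo \<open>J\<close>.\<close>
  have XpZ: "(X ^^ Suc m) (Z f) - Z ((X ^^ Suc m) f) - scal (of_nat (Suc m)) (C ((X ^^ m) f)) \<in> J"
    if f: "f \<in> T" for m f
  proof (induction m)
    case 0
    show ?case by (simp add: C tv.subspace_0[OF J] del: minus_apply zero_fun_apply)
  next
    case (Suc m)
    let ?E = "\<lambda>m. (X ^^ Suc m) (Z f) - Z ((X ^^ Suc m) f) - scal (of_nat (Suc m)) (C ((X ^^ m) f))"
    let ?k = "(X ^^ m) f"
    have XE: "X (?E m) = X ((X ^^ Suc m) (Z f)) - X (Z (X ?k)) - scal (of_nat (Suc m)) (X (C ?k))"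
      by (simp add: X.diff X.scale del: minus_apply of_nat_Suc)
    have ZX: "Z (X (X ?k)) = X (Z (X ?k)) - C (X ?k)" by (simp add: C)
    have add: "scal (of_nat (Suc (Suc m))) g = g + scal (of_nat (Suc m)) g" for g :: "nat list \<Rightarrow> 'a"
      unfolding of_nat_Suc[of "Suc m"] by (simp only: tv.scale_left_distrib tv.scale_one)
    have "?E (Suc m) = X (?E m) - scal (of_nat (Suc m)) (C (X ?k) - X (C ?k))"
      unfolding XE unfolding add unfolding funpow.simps comp_apply ZX tv.scale_right_diff_distrib
      by (simp add: algebra_simps del: minus_apply plus_fun_apply of_nat_Suc)
    also have "\<dots> \<in> J" by (intro closed XJ Suc.IH CX XpT f)
    finally show ?case .
  qed
  have CpZ: "(C ^^ m) (Z f) - Z ((C ^^ m) f) \<in> J" if f: "f \<in> T" for m f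
  proof (induction m)
    case 0
    show ?case by (simp add: tv.subspace_0[OF J] del: minus_apply zero_fun_apply)
  next
    case (Suc m)
    have "(C ^^ Suc m) (Z f) - Z ((C ^^ Suc m) f) =
        C ((C ^^ m) (Z f) - Z ((C ^^ m) f)) + (C (Z ((C ^^ m) f)) - Z (C ((C ^^ m) f)))"
      by (simp add: C.diff del: minus_apply plus_fun_apply)
    also have "\<dots> \<in> J" by (intro closed CJ Suc.IH CZ CpT f)
    finally show ?case .
  qed
  \<comment> \<open>The number \<open>m + j\<close> of factors stays fixed while factors
    \<open>X\<close> are traded for factors \<open>C\<close> one at a time.\<close>
  have main: "(\<And>f. f \<in> T \<Longrightarrow> (X ^^ (m + j)) f \<in> J) \<Longrightarrow> f \<in> T \<Longrightarrow> (C ^^ j) ((X ^^ m) f) \<in> J" for j m f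
  proof (induction j arbitrary: m f)
    case (Suc j)
    have IH: "(C ^^ j) ((X ^^ Suc m) g) \<in> J" if "g \<in> T" for g
      by (rule Suc.IH[OF _ that]) (use Suc.prems(1) in simp)
    interpret Cj: module_hom scal scal "C ^^ j" by (rule module_hom_funpow[OF hom(3)])
    let ?c = "of_nat (Suc m) :: 'a"
    have 1: "(C ^^ j) ((X ^^ Suc m) (Z f) - Z ((X ^^ Suc m) f) - scal ?c (C ((X ^^ m) f))) \<in> J"
      by (intro CpJ XpZ Suc.prems)
    have 2: "(C ^^ j) ((X ^^ Suc m) (Z f)) \<in> J" by (intro IH ZT Suc.prems)
    have 3: "(C ^^ j) (Z ((X ^^ Suc m) f)) - Z ((C ^^ j) ((X ^^ Suc m) f)) \<in> J"
      by (intro CpZ XpT Suc.prems)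
    have 4: "Z ((C ^^ j) ((X ^^ Suc m) f)) \<in> J" by (intro ZJ IH Suc.prems)
    \<comment> \<open>In the congruence \<open>XpZ\<close>, pushed through \<open>C ^^ j\<close>,
      the two terms with \<open>X ^^ Suc m\<close> lie in \<open>J\<close>, so the remaining
      multiple of \<open>C ((X ^^ m) f)\<close> does too.\<close>
    from closed(2)[OF closed(2)[OF 2 closed(1)[OF 3 4]] 1]
    have "scal ?c ((C ^^ j) (C ((X ^^ m) f))) \<in> J"
      by (simp add: Cj.diff Cj.scale del: minus_apply plus_fun_apply of_nat_Suc funpow.simps)
    then have "scal (inverse ?c) (scal ?c ((C ^^ j) (C ((X ^^ m) f)))) \<in> J" by (rule closed)
    then show ?case by (simp add: funpow_swap1 del: of_nat_Suc)
  qed simp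
  show ?thesis using main[of 0 N f] nil f by simp
qed

section \<open>Finite dimension and nilpotent operators\<close>

lemma fin_dim_mod_iff:
  "fin_dim_mod S K \<longleftrightarrow> (\<exists>B. finite B \<and> (\<forall>f\<in>S. \<exists>g\<in>tv.span B. f - g \<in> K))"
  unfolding fin_dim_mod_def
  by (rule ex_cong1, rule conj_cong[OF refl]) (auto simp: tv.span_finite)

lemma fin_dim_mod_mono:
  assumes "fin_dim_mod S K" "S' \<subseteq> S" "K \<subseteq> K'"
  shows "fin_dim_mod S' K'"
proof -
  obtain B where B: "finite B" "\<And>f. f \<in> S \<Longrightarrow> \<exists>g\<in>tv.span B. f - g \<in> K"
    using assms(1) unfolding fin_dim_mod_iff by blast
  have "\<exists>g\<in>tv.span B. f - g \<in> K'" if "f \<in> S'" for f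
    using B(2)[of f] that assms(2,3) by blast
  with B(1) show ?thesis unfolding fin_dim_mod_iff by blast
qed

text \<open>Iterating \<open>f = g + Y h\<close> modulo \<open>K\<close> expresses \<open>f\<close>
  through images of \<open>B\<close> under powers of \<open>Y\<close> below \<open>N\<close>, up to
  a remainder \<open>(Y ^^ N) h\<close> that lies in \<open>K\<close>.\<close>

lemma fin_dim_mod_nilpotent:
  assumes K: "tv.subspace K" and Y: "module_hom scal scal Y"
    and YK: "\<And>f. f \<in> K \<Longrightarrow> Y f \<in> K"
    and nil: "\<And>f. f \<in> S \<Longrightarrow> (Y ^^ N) f \<in> K"
    and B: "finite B" "\<And>f. f \<in> S \<Longrightarrow> \<exists>g\<in>tv.span B. \<exists>h\<in>S. f - g - Y h \<in> K"
  shows "fin_dim_mod S K"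
proof -
  have YpK: "(Y ^^ m) f \<in> K" if "f \<in> K" for m f using that by (induction m) (auto simp: YK)
  define D where "D m = (\<Union>e<m. (Y ^^ e) ` B)" for m
  have ex: "\<exists>g\<in>tv.span (D m). \<exists>h\<in>S. f - g - (Y ^^ m) h \<in> K" if f: "f \<in> S" for f m
  proof (induction m)
    case 0
    show ?case
      by (rule bexI[of _ 0], rule bexI[of _ f])
        (simp_all add: f tv.subspace_0[OF K] tv.span_zero del: minus_apply zero_fun_apply)
  next
    case (Suc m)
    interpret Ym: module_hom scal scal "Y ^^ m" by (rule module_hom_funpow[OF Y])
    obtain g h where gh: "g \<in> tv.span (D m)" "h \<in> S" "f - g - (Y ^^ m) h \<in> K" using Suc.IH by blast
    obtain g' h' where gh': "g' \<in> tv.span B" "h' \<in> S" "h - g' - Y h' \<in> K" using B(2)[OF gh(2)] by blast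
    have "(Y ^^ m) g' \<in> tv.span ((Y ^^ m) ` B)" using gh'(1) by (simp add: Ym.span_image)
    moreover have "(Y ^^ m) ` B \<subseteq> D (Suc m)" "D m \<subseteq> D (Suc m)"
      by (auto simp: D_def lessThan_Suc)
    ultimately have "g + (Y ^^ m) g' \<in> tv.span (D (Suc m))"
      using gh(1) tv.span_mono by (blast intro: tv.span_add)
    moreover have "f - (g + (Y ^^ m) g') - (Y ^^ Suc m) h' =
        (f - g - (Y ^^ m) h) + (Y ^^ m) (h - g' - Y h')"
      by (simp add: Ym.diff funpow_swap1 del: minus_apply plus_fun_apply)
    moreover have "\<dots> \<in> K" by (intro tv.subspace_add[OF K] gh(3) YpK gh'(3))
    ultimately show ?case using gh'(2) by (metis (lifting))
  qed
  have "\<exists>g\<in>tv.span (D N). f - g \<in> K" if f: "f \<in> S" for f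
  proof -
    obtain g h where "g \<in> tv.span (D N)" "h \<in> S" "f - g - (Y ^^ N) h \<in> K" using ex[OF f, of N] by blast
    moreover then have "f - g - (Y ^^ N) h + (Y ^^ N) h \<in> K" by (intro tv.subspace_add[OF K] nil)
    ultimately show ?thesis by (auto simp del: minus_apply plus_fun_apply)
  qed
  moreover have "finite (D N)" using B(1) by (simp add: D_def)
  ultimately show ?thesis unfolding fin_dim_mod_iff by blast
qed

text \<open>In the twisted algebra this is the right ideal generated by the Nichols ideal and the
  brackets of the words in \<open>S\<close>, because \<open>ad_op s w f\<close> is a bracket times
  \<open>f\<close>.\<close>

definition ad_span where
  "ad_span n p s S =
     tv.span (nichols_ideal n p \<union> {ad_op s w f | w f. w \<in> S \<and> f \<in> tens n})"

lemma subspace_ad_span: "tv.subspace (ad_span n p s S)"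
  by (simp add: ad_span_def)

lemma ideal_ad_span: "f \<in> nichols_ideal n p \<Longrightarrow> f \<in> ad_span n p s S"
  by (simp add: ad_span_def tv.span_base)

lemma ad_op_ad_span: "w \<in> S \<Longrightarrow> f \<in> tens n \<Longrightarrow> ad_op s w f \<in> ad_span n p s S"
  unfolding ad_span_def by (rule tv.span_base) blast

lemma ad_span_induct [consumes 1, case_names ideal ad_op closed]:
  assumes "f \<in> ad_span n p s S"
    and "\<And>f. f \<in> nichols_ideal n p \<Longrightarrow> f \<in> J"
    and "\<And>w f. w \<in> S \<Longrightarrow> f \<in> tens n \<Longrightarrow> ad_op s w f \<in> J"
    and "tv.subspace J"
  shows "f \<in> J"
proof -
  have "tv.span (nichols_ideal n p \<union> {ad_op s w f | w f. w \<in> S \<and> f \<in> tens n}) \<subseteq> J"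
    by (rule tv.span_minimal) (use assms in auto)
  with assms(1) show ?thesis by (auto simp: ad_span_def)
qed

lemma subspace_vimage:
  assumes "module_hom scal scal T" "tv.subspace J"
  shows "tv.subspace {f. T f \<in> J}"
proof -
  interpret T: module_hom scal scal T by (fact assms)
  show ?thesis using assms(2) by (auto simp: tv.subspace_def T.add T.scale T.zero)
qed

text \<open>A letter moves past a bracket \<open>c\<close> by
  \<open>x_i c = [x_i, c] + c x_i\<close>, and the longer bracket is again in \<open>S\<close>. So
  closure under prefixing letters makes the right ideal stable under left multiplication
  too.\<close>

lemma tlmul_ad_span:
  assumes i: "i < n" and S: "\<And>w. w \<in> S \<Longrightarrow> w \<noteq> [] \<and> i # w \<in> S"
    and f: "f \<in> ad_span n p s S"
  shows "tlmul s i f \<in> ad_span n p s S"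
proof -
  from f have "f \<in> {f. tlmul s i f \<in> ad_span n p s S}"
  proof (induction rule: ad_span_induct)
    case (ideal f)
    then show ?case using i by (simp add: tlmul_ideal ideal_ad_span)
  next
    case (ad_op w f)
    have "tlmul s i (ad_op s w f) = ad_op s (i # w) f + ad_op s w (tlmul s i f)"
      using S[OF ad_op(1)] by (simp add: ad_op_Cons)
    also have "\<dots> \<in> ad_span n p s S"
      using S[OF ad_op(1)] ad_op i
      by (intro tv.subspace_add[OF subspace_ad_span] ad_op_ad_span tlmul_tens) auto
    finally show ?case by simp
  next
    case closed
    show ?case by (intro subspace_vimage module_hom_tlmul subspace_ad_span)
  qed
  then show ?thesis by simp
qed

text \<open>An operator commuting with all letters modulo \<open>J\<close> also commutes with their
  iterated commutators, as \<open>J\<close> is stable under the letters.\<close>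

lemma ad_op_commute:
  assumes J: "tv.subspace J" and set: "set u \<subseteq> {..<n}"
    and XJ: "\<And>i f. i < n \<Longrightarrow> f \<in> J \<Longrightarrow> tlmul s i f \<in> J"
    and w: "set w \<subseteq> {..<n}"
    and comm: "\<And>i f. i < n \<Longrightarrow> f \<in> tens n \<Longrightarrow> ad_op s w (tlmul s i f) - tlmul s i (ad_op s w f) \<in> J"
    and f: "f \<in> tens n"
  shows "ad_op s w (ad_op s u f) - ad_op s u (ad_op s w f) \<in> J"
  using set f
proof (induction u arbitrary: f rule: ad_op_induct)
  case Nil
  interpret module_hom scal scal "ad_op s w" by (rule module_hom_ad_op)
  show ?case by (simp add: zero tv.subspace_0[OF J] del: minus_apply zero_fun_apply)
next
  case (single i)
  then show ?case by (simp add: comm del: minus_apply)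
next
  case (Cons i u)
  interpret W: module_hom scal scal "ad_op s w" by (rule module_hom_ad_op)
  interpret U: module_hom scal scal "ad_op s u" by (rule module_hom_ad_op)
  let ?X = "tlmul s i" and ?W = "ad_op s w" and ?U = "ad_op s u"
  have i: "i < n" and u: "set u \<subseteq> {..<n}" using Cons.prems by auto
  have UJ: "f \<in> J \<Longrightarrow> ?U f \<in> J" for f by (rule ad_op_closed[OF J]) (use u XJ in auto)
  have "?W (ad_op s (i # u) f) - ad_op s (i # u) (?W f) =
      (?W (?X (?U f)) - ?X (?W (?U f))) + ?X (?W (?U f) - ?U (?W f))
      - (?W (?U (?X f)) - ?U (?W (?X f))) - ?U (?W (?X f) - ?X (?W f))"
    by (simp add: ad_op_Cons[OF Cons.hyps] W.diff U.diff del: minus_apply plus_fun_apply)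
  also have "\<dots> \<in> J"
    by (intro tv.subspace_add[OF J] tv.subspace_diff[OF J] comm XJ UJ Cons.IH i u
        ad_op_tens tlmul_tens Cons.prems)
  finally show ?case .
qed

text \<open>All \<open>i # w\<close> being in \<open>S\<close>, the bracket of \<open>w\<close> is
  central modulo the smaller ideal. It is also nilpotent there, so finite dimension lifts from the
  quotient by it.\<close>

lemma fin_dim_mod_ad_span_step:
  fixes p s :: "nat \<Rightarrow> nat \<Rightarrow> 'a::field_char_0"
  assumes nil: "\<And>i. i < n \<Longrightarrow> \<exists>N. \<forall>f\<in>tens n. (tlmul s i ^^ N) f \<in> nichols_ideal n p"
    and S: "\<And>u i. u \<in> S \<Longrightarrow> i < n \<Longrightarrow> u \<noteq> [] \<and> i # u \<in> S"
    and w: "w \<noteq> []" "set w \<subseteq> {..<n}" "\<And>i. i < n \<Longrightarrow> i # w \<in> S"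
    and fd: "fin_dim_mod (tens n) (ad_span n p s (insert w S))"
  shows "fin_dim_mod (tens n) (ad_span n p s S)"
proof -
  let ?J = "ad_span n p s S"
  note J = subspace_ad_span[of n p s S]
  have XJ: "tlmul s i f \<in> ?J" if "i < n" "f \<in> ?J" for i f
    using that S by (intro tlmul_ad_span) auto
  have YJ: "ad_op s u f \<in> ?J" if "set u \<subseteq> {..<n}" "f \<in> ?J" for u f
    by (rule ad_op_closed[OF J]) (use that XJ in auto)
  have comm: "ad_op s w (tlmul s i f) - tlmul s i (ad_op s w f) \<in> ?J" if "i < n" "f \<in> tens n" for i f
  proof -
    have "ad_op s w (tlmul s i f) - tlmul s i (ad_op s w f) = - ad_op s (i # w) f"
      by (simp add: ad_op_Cons[OF w(1)])
    also have "\<dots> \<in> ?J" using that w(3) by (intro tv.subspace_neg[OF J] ad_op_ad_span)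
    finally show ?thesis .
  qed
  \<comment> \<open>A single letter is nilpotent by hypothesis; a longer bracket is a commutator of
    its nilpotent first letter with the bracket of the rest.\<close>
  have "\<exists>N. \<forall>f\<in>tens n. (ad_op s w ^^ N) f \<in> ?J"
  proof (cases "tl w = []")
    case True
    then obtain i where i: "w = [i]" "i < n" using w by (cases w) auto
    then have "ad_op s w = tlmul s i" by auto
    then show ?thesis using nil[OF i(2)] ideal_ad_span by metis
  next
    case False
    then obtain i u where iu: "w = i # u" "u \<noteq> []" "i < n" "set u \<subseteq> {..<n}"
      using w by (cases w) auto
    obtain N where N: "\<forall>f\<in>tens n. (tlmul s i ^^ N) f \<in> nichols_ideal n p" using nil[OF iu(3)] by blast
    have "(ad_op s w ^^ N) f \<in> ?J" if "f \<in> tens n" for f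
    proof (rule commutator_nilpotent[where X = "tlmul s i" and Z = "ad_op s u" and T = "tens n"])
      show "ad_op s w f = tlmul s i (ad_op s u f) - ad_op s u (tlmul s i f)" for f
        by (simp add: iu(1) ad_op_Cons[OF iu(2)])
      show "ad_op s w (ad_op s u f) - ad_op s u (ad_op s w f) \<in> ?J" if "f \<in> tens n" for f
        by (rule ad_op_commute[OF J iu(4) XJ w(2) comm that])
      show "ad_op s w f \<in> tens n" if "f \<in> tens n" for f
        by (rule ad_op_tens[OF w(2) that])
    qed (use that N iu w XJ YJ comm in \<open>auto intro: J module_hom_tlmul module_hom_ad_op
          tlmul_tens ad_op_tens ideal_ad_span simp del: minus_apply\<close>)
    then show ?thesis by blast
  qed
  then obtain N where N: "\<And>f. f \<in> tens n \<Longrightarrow> (ad_op s w ^^ N) f \<in> ?J" by blast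
  obtain B where B: "finite B" "\<And>f. f \<in> tens n \<Longrightarrow> \<exists>g\<in>tv.span B. f - g \<in> ad_span n p s (insert w S)"
    using fd unfolding fin_dim_mod_iff by blast
  interpret W: module_hom scal scal "ad_op s w" by (rule module_hom_ad_op)
  \<comment> \<open>The two ideals differ only by multiples of the bracket of \<open>w\<close>,
    which supplies the \<open>Y h\<close> of \<open>fin_dim_mod_nilpotent\<close>.\<close>
  have split: "f \<in> {f. \<exists>h\<in>tens n. f - ad_op s w h \<in> ?J}" if "f \<in> ad_span n p s (insert w S)" for f
    using that
  proof (induction rule: ad_span_induct)
    case (ideal f)
    then show ?case
      by (auto intro!: bexI[of _ 0] simp: W.zero tv.subspace_0[OF subspace_tens] ideal_ad_span)
  next
    case (ad_op u f)
    show ?case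
    proof (cases "u = w")
      case True
      then show ?thesis using ad_op(2) tv.subspace_0[OF J]
        by (auto intro!: bexI[of _ f] simp del: minus_apply)
    next
      case False
      then show ?thesis using ad_op ad_op_ad_span[of u S f n s p]
        by (auto intro!: bexI[of _ 0] simp: W.zero tv.subspace_0[OF subspace_tens])
    qed
  next
    case closed
    show ?case
    proof (rule tv.subspaceI)
      show "0 \<in> {f. \<exists>h\<in>tens n. f - ad_op s w h \<in> ?J}"
        by (auto intro!: bexI[of _ 0] simp: W.zero tv.subspace_0[OF subspace_tens] tv.subspace_0[OF J])
    next
      fix f g
      assume "f \<in> {f. \<exists>h\<in>tens n. f - ad_op s w h \<in> ?J}" "g \<in> {f. \<exists>h\<in>tens n. f - ad_op s w h \<in> ?J}"
      then obtain h k where h: "h \<in> tens n" "f - ad_op s w h \<in> ?J" and k: "k \<in> tens n" "g - ad_op s w k \<in> ?J"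
        by blast
      have "f + g - ad_op s w (h + k) = (f - ad_op s w h) + (g - ad_op s w k)"
        by (simp add: W.add del: minus_apply plus_fun_apply)
      also have "\<dots> \<in> ?J" by (intro tv.subspace_add[OF J] h k)
      finally show "f + g \<in> {f. \<exists>h\<in>tens n. f - ad_op s w h \<in> ?J}"
        using tv.subspace_add[OF subspace_tens h(1) k(1)] by blast
    next
      fix c f
      assume "f \<in> {f. \<exists>h\<in>tens n. f - ad_op s w h \<in> ?J}"
      then obtain h where h: "h \<in> tens n" "f - ad_op s w h \<in> ?J" by blast
      have "scal c f - ad_op s w (scal c h) = scal c (f - ad_op s w h)"
        by (simp add: W.scale tv.scale_right_diff_distrib)
      also have "\<dots> \<in> ?J" by (intro tv.subspace_scale[OF J] h)
      finally show "scal c f \<in> {f. \<exists>h\<in>tens n. f - ad_op s w h \<in> ?J}"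
        using tv.subspace_scale[OF subspace_tens h(1)] by blast
    qed
  qed
  have "\<exists>g\<in>tv.span B. \<exists>h\<in>tens n. f - g - ad_op s w h \<in> ?J" if "f \<in> tens n" for f
    using B(2)[OF that] split by blast
  from fin_dim_mod_nilpotent[OF J module_hom_ad_op YJ[OF w(2)] N B(1) this] show ?thesis .
qed

text \<open>The one-letter brackets already generate every nonempty word, so only the constant term
  survives.\<close>

lemma fin_dim_mod_ad_span_all:
  fixes p s :: "nat \<Rightarrow> nat \<Rightarrow> 'a::field"
  assumes s: "\<And>i j. i < n \<Longrightarrow> j < n \<Longrightarrow> s i j \<noteq> 0"
  shows "fin_dim_mod (tens n) (ad_span n p s {w. w \<noteq> [] \<and> set w \<subseteq> {..<n}})"
proof -
  let ?J = "ad_span n p s {w. w \<noteq> [] \<and> set w \<subseteq> {..<n}}"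
  note J = subspace_ad_span[of n p s "{w. w \<noteq> [] \<and> set w \<subseteq> {..<n}}"]
  have single: "single (i # u) \<in> ?J" if iu: "i < n" "set u \<subseteq> {..<n}" for i u
  proof -
    have "chi (s i) u \<noteq> 0" using iu(2) by (induction u) (auto simp: s iu(1))
    then have "single (i # u) = scal (inverse (chi (s i) u)) (ad_op s [i] (single u))"
      by (simp add: tlmul_def)
    also have "\<dots> \<in> ?J" using iu by (intro tv.subspace_scale[OF J] ad_op_ad_span tens_single) auto
    finally show ?thesis .
  qed
  have "\<exists>g\<in>tv.span {single []}. f - g \<in> ?J" if f: "f \<in> tens n" for f
  proof
    let ?g = "scal (f []) (single [])" and ?h = "f - scal (f []) (single [])"
    have "?h \<in> tens n"
      using f by (intro tv.subspace_diff[OF subspace_tens] tv.subspace_scale[OF subspace_tens] tens_single) auto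
    moreover have "?h [] = 0" by (simp add: scal_def single_def)
    ultimately have "(\<Sum>w\<in>supp ?h. scal (?h w) (single w)) \<in> ?J"
    proof (intro tv.subspace_sum[OF J] tv.subspace_scale[OF J])
      fix w assume h: "?h \<in> tens n" "?h [] = 0" and "w \<in> supp ?h"
      then have "?h w \<noteq> 0" by (simp add: supp_def)
      then have "w \<noteq> []" "set w \<subseteq> {..<n}" using h by (auto simp: tens_def simp del: minus_apply)
      then show "single w \<in> ?J" using single by (cases w) auto
    qed
    then show "?h \<in> ?J" using sum_single[OF finite_supp_tens[OF \<open>?h \<in> tens n\<close>]] by simp
    show "?g \<in> tv.span {single []}" by (intro tv.span_scale tv.span_base) simp
  qed
  then show ?thesis unfolding fin_dim_mod_iff by (intro exI[of _ "{single []}"]) auto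
qed

text \<open>Induction on the set \<open>C\<close> of brackets not divided out. Closure of
  \<open>C\<close> under nonempty tails keeps its complement closed under prefixing letters.\<close>

lemma fin_dim_mod_ad_span_cofinite:
  fixes p s :: "nat \<Rightarrow> nat \<Rightarrow> 'a::field_char_0"
  assumes nil: "\<And>i. i < n \<Longrightarrow> \<exists>N. \<forall>f\<in>tens n. (tlmul s i ^^ N) f \<in> nichols_ideal n p"
    and s: "\<And>i j. i < n \<Longrightarrow> j < n \<Longrightarrow> s i j \<noteq> 0"
    and C: "finite C" "C \<subseteq> {w. w \<noteq> [] \<and> set w \<subseteq> {..<n}}"
      "\<And>i w. i # w \<in> C \<Longrightarrow> w \<noteq> [] \<Longrightarrow> w \<in> C"
  shows "fin_dim_mod (tens n) (ad_span n p s ({w. w \<noteq> [] \<and> set w \<subseteq> {..<n}} - C))"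
  using C
proof (induction C rule: finite_psubset_induct)
  case (psubset C)
  let ?W = "{w. w \<noteq> [] \<and> set w \<subseteq> {..<n}}"
  show ?case
  proof (cases "C = {}")
    case True
    then show ?thesis using fin_dim_mod_ad_span_all[OF s] by simp
  next
    case False
    then have "Max (length ` C) \<in> length ` C" using psubset.hyps by (intro Max_in) auto
    \<comment> \<open>A word of maximal length, so that prefixing any letter leads out of
      \<open>C\<close>.\<close>
    then obtain w where w: "w \<in> C" "Max (length ` C) = length w" by blast
    have max: "length u \<le> length w" if "u \<in> C" for u
      unfolding w(2)[symmetric] using psubset.hyps that by (intro Max_ge) auto
    have notin: "i # w \<notin> C" for i using max[of "i # w"] by auto
    have "fin_dim_mod (tens n) (ad_span n p s (?W - (C - {w})))"
    proof (rule psubset.IH)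
      show "C - {w} \<subset> C" using w by auto
      show "C - {w} \<subseteq> ?W" using psubset.prems(1) by auto
      show "u \<in> C - {w}" if "i # u \<in> C - {w}" "u \<noteq> []" for i u
        using that psubset.prems(2) notin by auto
    qed
    moreover have "?W - (C - {w}) = insert w (?W - C)" using w psubset.prems(1) by auto
    ultimately have fd: "fin_dim_mod (tens n) (ad_span n p s (insert w (?W - C)))" by simp
    show ?thesis
    proof (rule fin_dim_mod_ad_span_step[OF nil _ _ _ _ fd])
      show "u \<noteq> [] \<and> i # u \<in> ?W - C" if "u \<in> ?W - C" "i < n" for u i
        using that psubset.prems(2) by auto
    qed (use w notin psubset.prems(1) in auto)
  qed
qed

lemma fin_dim_of_lie_gen:
  fixes p s :: "nat \<Rightarrow> nat \<Rightarrow> 'a::field_char_0"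
  assumes fd: "fin_dim_mod (lie_gen n (bracketR s)) (nichols_ideal n p)"
    and s: "\<And>i j. i < n \<Longrightarrow> j < n \<Longrightarrow> s i j \<noteq> 0"
    and nbr: "\<And>i. i < n \<Longrightarrow> \<exists>j<n. i \<noteq> j \<and> p i j * p j i \<noteq> 1"
  shows "fin_dim_mod (tens n) (nichols_ideal n p)"
proof -
  have nil: "\<exists>N. \<forall>f\<in>tens n. (tlmul s i ^^ N) f \<in> nichols_ideal n p" if "i < n" for i
    using nbr[OF that] tlmul_nilpotent[OF fd s that] by blast
  obtain N where N: "\<And>w (f :: nat list \<Rightarrow> 'a). set w \<subseteq> {..<n} \<Longrightarrow> N < length w \<Longrightarrow> f \<in> tens n \<Longrightarrow>
      ad_op s w f \<in> nichols_ideal n p"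
    using ad_op_eventually_ideal[OF fd s] by blast
  \<comment> \<open>The finitely many nonempty words of length at most \<open>N\<close>; all other
    brackets already lie in the ideal, so dividing them out changes nothing.\<close>
  define C where "C = {w. set w \<subseteq> {..<n} \<and> length w \<le> N} - {[]}"
  have "fin_dim_mod (tens n) (ad_span n p s ({w. w \<noteq> [] \<and> set w \<subseteq> {..<n}} - C))"
    by (rule fin_dim_mod_ad_span_cofinite[OF nil s])
      (auto simp: C_def finite_lists_length_le)
  moreover have "f \<in> nichols_ideal n p"
    if "f \<in> ad_span n p s ({w. w \<noteq> [] \<and> set w \<subseteq> {..<n}} - C)" for f
    using that
  proof (induction rule: ad_span_induct)
    case (ad_op w f)
    then show ?case by (intro N) (auto simp: C_def)
  qed (simp_all add: subspace_nichols_ideal)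
  ultimately show ?thesis by (meson fin_dim_mod_mono order_refl subsetI)
qed

section \<open>The equivalence for both brackets\<close>

lemma tens_bracketR:
  assumes "f \<in> tens n" "g \<in> tens n"
  shows "bracketR s f g \<in> tens n"
  unfolding bracketR_def
proof (intro tv.subspace_sum[OF subspace_tens] tv.subspace_scale[OF subspace_tens]
    tv.subspace_diff[OF subspace_tens] tens_single)
  fix u v assume "u \<in> supp f" "v \<in> supp g"
  then have "set u \<subseteq> {..<n}" "set v \<subseteq> {..<n}" using assms by (auto simp: tens_def supp_def)
  then show "set (u @ v) \<subseteq> {..<n}" "set (v @ u) \<subseteq> {..<n}" by auto
qed

lemma lie_gen_subset_tens: "lie_gen n (bracketR s) \<subseteq> tens n"
proof
  fix f :: "nat list \<Rightarrow> 'a" assume "f \<in> lie_gen n (bracketR s)"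
  then show "f \<in> tens n"
    by induction (simp_all add: tens_single tens_bracketR tv.subspace_0[OF subspace_tens]
        tv.subspace_add[OF subspace_tens] tv.subspace_scale[OF subspace_tens]
        del: plus_fun_apply zero_fun_apply)
qed

lemma bracketL_conv_bracketR: "bracketL p = bracketR (\<lambda>i j. p j i)"
proof -
  have "pw (\<lambda>i j. p j i) u v = pw p v u" for u v
    unfolding pw_def by (rule prod.swap)
  then show ?thesis by (simp add: bracketL_def bracketR_def fun_eq_iff)
qed

text \<open>A chain from \<open>i\<close> to another letter leaves \<open>i\<close> at some step,
  and that step exhibits the neighbour.\<close>

lemma connected_diag_neighbour:
  assumes "connected_diag n p" "n > 1" "i < n"
  shows "\<exists>j<n. i \<noteq> j \<and> p i j * p j i \<noteq> 1"
proof -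
  define k where "k = (if i = 0 then 1 else 0 :: nat)"
  have k: "k < n" "i \<noteq> k" using assms(2) by (auto simp: k_def)
  then obtain l where l: "l \<noteq> []" "hd l = i" "last l = k" "set l \<subseteq> {..<n}"
      "\<And>t. Suc t < length l \<Longrightarrow> p (l ! t) (l ! Suc t) * p (l ! Suc t) (l ! t) \<noteq> 1"
    using assms unfolding connected_diag_def by blast
  have "\<exists>t. Suc t < length l \<and> l ! t = i \<and> l ! Suc t \<noteq> i"
  proof (rule ccontr)
    assume no: "\<not> ?thesis"
    have "t < length l \<Longrightarrow> l ! t = i" for t
      by (induction t) (use l no in \<open>auto simp: hd_conv_nth\<close>)
    then have "last l = i" using l(1) by (simp add: last_conv_nth)
    then show False using l(3) k(2) by simp
  qed
  then obtain t where t: "Suc t < length l" "l ! t = i" "l ! Suc t \<noteq> i" by blast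
  then have "l ! Suc t < n" using l(4) nth_mem by blast
  then show ?thesis using t l(5)[OF t(1)] by metis
qed

theorem theorem6p15:
  fixes n :: nat and p :: "nat \<Rightarrow> nat \<Rightarrow> 'a::field_char_0"
  assumes "n > 1"
    and "\<forall>i<n. \<forall>j<n. p i j \<noteq> 0"
    and "connected_diag n p"
  shows "(fin_dim_mod (tens n) (nichols_ideal n p) \<longleftrightarrow>
            fin_dim_mod (lie_gen n (bracketL p)) (nichols_ideal n p))
       \<and> (fin_dim_mod (lie_gen n (bracketL p)) (nichols_ideal n p) \<longleftrightarrow>
            fin_dim_mod (lie_gen n (bracketR p)) (nichols_ideal n p))"
proof -
  \<comment> \<open>The bicharacter \<open>s\<close> of the bracket is independent of the matrix
    \<open>p\<close> of the ideal, so one argument covers \<open>s = p\<close> and its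
    transpose.\<close>
  have "fin_dim_mod (lie_gen n (bracketR s)) (nichols_ideal n p) \<longleftrightarrow>
      fin_dim_mod (tens n) (nichols_ideal n p)" if "\<And>i j. i < n \<Longrightarrow> j < n \<Longrightarrow> s i j \<noteq> 0" for s
    using fin_dim_of_lie_gen[OF _ that connected_diag_neighbour[OF assms(3,1)]]
      fin_dim_mod_mono[OF _ lie_gen_subset_tens order_refl] by (rule iffI)
  from this[of p] this[of "\<lambda>i j. p j i"] show ?thesis
    using assms(2) by (simp add: bracketL_conv_bracketR)
qed

end
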